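(* Fix an integer $l>0$ and, for each $n$, let $X,Y$ be the random binary strings of length $n$ of the i.i.d. block model with parameter $l$, let $\tilde X$ be the random modification of $X$, let $L_n=|\mathrm{LCS}(X,Y)|$ and $\tilde L_n=|\mathrm{LCS}(\tilde X,Y)|$ (all defined in the context). Assume that there exist $\epsilon>0$ and $\alpha>0$, not depending on $n$, such that for all $n$ large enough $$\mathrm{P}\left(\mathrm{E}[\tilde L_n-L_n\mid X,Y]\ge \epsilon\right)\ \ge\ 1-\exp(-n^{\alpha}).$$ Then $\mathrm{VAR}[L_n]=\Theta(n)$ for $n$ large enough; that is, there are constants $0<C_1\le C_2$ not depending on $n$ with $C_1 n\le \mathrm{VAR}[L_n]\le C_2 n$ for all $n$ large enough.
   Context: Block model. Let $l>0$ be an integer. Let $B_{X1},B_{X2},\dots$ and $B_{Y1},B_{Y2},\dots$ be two i.i.d. sequences, independent of each other, each variable taking the values $l-1,l,l+1$ with probability $1/3$ each. $X^\infty=X_1X_2X_3\cdots$ is the infinite binary sequence obtained by concatenating blocks (a block is a run of equal symbols) of lengths $B_{X1},B_{X2},\dots$, the symbol alternating between $0$ and $1$ from one block to the next, where the first symbol is $0$ or $1$ with probability $1/2$ each. $Y^\infty$ is built in the same way from $B_{Y1},B_{Y2},\dots$ with its own fair first symbol. The first symbols and the block lengths are all independent. Put $X=X_1\cdots X_n$ and $Y=Y_1\cdots Y_n$. LCS. A common subsequence of two strings is a string that is a (not necessarily contiguous) subsequence of both; $|\mathrm{LCS}(x,y)|$ is the maximal length of a common subsequence of $x$ and $y$.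 Random modification. Let $T=\max\{k: B_{X1}+\dots+B_{Xk}\le n\}$; the blocks of $X$ are the first $T$ blocks (a last block of $X^\infty$ that is cut by the truncation to length $n$ is a "rest" and is not counted as a block). Choose, uniformly at random among all blocks of $X$ of length $l-1$, one such block, and, uniformly at random among all blocks of $X$ of length $l+1$, one such block (the choices being independent of each other and of $Y$ given $X$ and its blocks). Change the length of both chosen blocks to $l$ (keeping their symbols). The resulting string, again of length $n$, is $\tilde X$. If $X$ has no block of length $l-1$ or no block of length $l+1$, put $\tilde X=X$. *)

theory Defs
  imports "HOL-Probability.Probability" "HOL-Library.Sublist"
begin

text \<open>Blocks and positions are numbered from 0. The position \<open>i\<close> lies in the first block whose
  right end exceeds \<open>i\<close>; blocks of length 0 (which occur for \<open>l = 1\<close>) are thereby skipped, while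
  still switching the symbol. If the block lengths have a finite sum, the symbols beyond that sum
  are unspecified; under the model below this is a null event.\<close>

definition block_seq :: "nat \<Rightarrow> (nat \<Rightarrow> nat) \<Rightarrow> nat \<Rightarrow> nat" where
  "block_seq s b i = (s + (LEAST k. i < (\<Sum>j\<le>k. b j))) mod 2"

definition block_string :: "nat \<Rightarrow> (nat \<Rightarrow> nat) \<Rightarrow> nat \<Rightarrow> nat list" where
  "block_string s b n = map (block_seq s b) [0..<n]"

definition num_blocks :: "(nat \<Rightarrow> nat) \<Rightarrow> nat \<Rightarrow> nat" where
  "num_blocks b n = Max {k. (\<Sum>j<k. b j) \<le> n}"

definition blocks :: "(nat \<Rightarrow> nat) \<Rightarrow> nat \<Rightarrow> nat list" where
  "blocks b n = map b [0..<num_blocks b n]"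

definition blocks_of_length :: "nat \<Rightarrow> nat list \<Rightarrow> nat set" where
  "blocks_of_length m bs = {k. k < length bs \<and> bs ! k = m}"

text \<open>\<open>i\<close> and \<open>j\<close> are the chosen blocks of lengths \<open>l - 1\<close> and \<open>l + 1\<close>. As the total length of the
  two is preserved, all the other blocks, including the cut rest at the end, keep their length
  when the sequence built from the new block lengths is truncated at \<open>n\<close> again.\<close>

definition modify_blocks :: "nat \<Rightarrow> nat \<Rightarrow> (nat \<Rightarrow> nat) \<Rightarrow> nat \<Rightarrow> nat \<Rightarrow> nat \<Rightarrow> nat" where
  "modify_blocks l n b i j =
     (if blocks_of_length (l - 1) (blocks b n) = {} \<or> blocks_of_length (l + 1) (blocks b n) = {}
      then b else b(i := l, j := l))"

definition lcs :: "'c list \<Rightarrow> 'c list \<Rightarrow> nat" where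
  "lcs x y = Max {length z | z. subseq z x \<and> subseq z y}"

datatype source = SymX | SymY | LenX nat | LenY nat

text \<open>\<open>I n\<close> and \<open>J n\<close> are the indices of the two blocks of \<open>X = X\<^sub>1 \<dots> X\<^sub>n\<close> chosen for
  modification. The last assumption says that, given \<open>X\<close>, its blocks, and \<open>Y\<close>, they are
  independent and uniform on the blocks of lengths \<open>l - 1\<close> and \<open>l + 1\<close>. The blocks are
  conditioned on separately since \<open>X\<close> alone does not determine them: its last run may be a
  block or a cut rest. Nothing is required of \<open>I n\<close> and \<open>J n\<close> if one of the two sets is empty.\<close>

locale block_model = prob_space M for M :: "'a measure" +
  fixes l :: nat
    and sX sY :: "'a \<Rightarrow> nat"
    and BX BY :: "nat \<Rightarrow> 'a \<Rightarrow> nat"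
    and I J :: "nat \<Rightarrow> 'a \<Rightarrow> nat"
    and X Y X' :: "nat \<Rightarrow> 'a \<Rightarrow> nat list"
  assumes l_pos: "l > 0"
    and indep_sources:
      "indep_vars (\<lambda>_. count_space UNIV)
         (\<lambda>v. case v of SymX \<Rightarrow> sX | SymY \<Rightarrow> sY | LenX k \<Rightarrow> BX k | LenY k \<Rightarrow> BY k) UNIV"
    and law_sX: "distr M (count_space UNIV) sX = measure_pmf (pmf_of_set {0, 1})"
    and law_sY: "distr M (count_space UNIV) sY = measure_pmf (pmf_of_set {0, 1})"
    and law_BX: "\<And>k. distr M (count_space UNIV) (BX k) = measure_pmf (pmf_of_set {l - 1, l, l + 1})"
    and law_BY: "\<And>k. distr M (count_space UNIV) (BY k) = measure_pmf (pmf_of_set {l - 1, l, l + 1})"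
    and X_eq: "\<And>n \<omega>. X n \<omega> = block_string (sX \<omega>) (\<lambda>k. BX k \<omega>) n"
    and Y_eq: "\<And>n \<omega>. Y n \<omega> = block_string (sY \<omega>) (\<lambda>k. BY k \<omega>) n"
    and X'_eq: "\<And>n \<omega>. X' n \<omega> =
      block_string (sX \<omega>) (modify_blocks l n (\<lambda>k. BX k \<omega>) (I n \<omega>) (J n \<omega>)) n"
    and measurable_I: "\<And>n. I n \<in> measurable M (count_space UNIV)"
    and measurable_J: "\<And>n. J n \<in> measurable M (count_space UNIV)"
    and choice_law: "\<And>n x bs y i j.
      prob {\<omega> \<in> space M. X n \<omega> = x \<and> blocks (\<lambda>k. BX k \<omega>) n = bs \<and> Y n \<omega> = y} > 0 \<Longrightarrow>
      blocks_of_length (l - 1) bs \<noteq> {} \<Longrightarrow> blocks_of_length (l + 1) bs \<noteq> {} \<Longrightarrow>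
      cond_prob M (\<lambda>\<omega>. I n \<omega> = i \<and> J n \<omega> = j)
          (\<lambda>\<omega>. X n \<omega> = x \<and> blocks (\<lambda>k. BX k \<omega>) n = bs \<and> Y n \<omega> = y) =
        pmf (pmf_of_set (blocks_of_length (l - 1) bs)) i *
        pmf (pmf_of_set (blocks_of_length (l + 1) bs)) j"

definition sigma_XY :: "'a measure \<Rightarrow> ('a \<Rightarrow> 'b) \<Rightarrow> ('a \<Rightarrow> 'c) \<Rightarrow> 'a measure" where
  "sigma_XY M U V = vimage_algebra (space M) (\<lambda>\<omega>. (U \<omega>, V \<omega>)) (count_space UNIV)"

end

theory Submission
  imports Defs
begin

text \<open>Write \<open>a\<close>, \<open>m\<close>, \<open>c\<close> for the numbers of blocks of \<open>X\<close> of lengths \<open>l - 1\<close>, \<open>l\<close>, \<open>l + 1\<close>.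
  The block sequences are uniformly distributed and turning a short and a long block into two
  blocks of length \<open>l\<close> can be undone once the two places are known, so, for \<open>L\<close> and \<open>L'\<close> the
  common subsequence lengths of \<open>X\<close> and of the modified string with \<open>Y\<close>,
  \<open>E[a c L'] = E[m (m - 1) L]\<close>. Hence \<open>E[a c (L' - L)]\<close> is the
  covariance of \<open>L\<close> with \<open>m (m - 1) - a c\<close>, a centred variable whose second moment is of order
  \<open>n^3\<close>. As \<open>a c\<close> concentrates around \<open>(n / (3 l))^2\<close> and \<open>L' - L\<close> is bounded, the
  assumption makes this covariance at least of order \<open>n^2\<close>, and the Cauchy-Schwarz inequality
  gives a variance at least of order \<open>n\<close>. The moments are those of stopped sums of centred
  functions of the block lengths. The upper bound is a bounded differences argument on the first
  \<open>2 n\<close> blocks of both strings, which cover \<open>n\<close> symbols up to probability \<open>4 / n\<close>.\<close>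

section \<open>Block strings and common subsequences\<close>

text \<open>Each admissible pair of blocks is chosen with probability \<open>1 / (a c)\<close>.
  Weighting by \<open>a c\<close> cancels this, so the modification becomes a plain sum over pairs
  of places, to which the reversal applies; no random denominator has to be controlled. The obstacle
  is that the number of blocks of \<open>X\<close> is random. \<open>X\<close> is therefore read
  from a word of fixed length \<open>K\<close> of independent uniform lengths, stopped at the first
  block that overshoots \<open>n\<close>. Changing lengths \<open>l - 1\<close> and
  \<open>l + 1\<close> into \<open>l\<close> and \<open>l\<close> keeps the total of the full
  blocks, hence the stopping place and the cut rest, so the reversal is compatible with stopping.
  Fixing \<open>K\<close> turns laws into averages over finitely many words. For
  \<open>l = 1\<close> blocks of length 0 occur and no number of blocks surely covers
  \<open>n\<close> symbols; \<open>2 n\<close> blocks have mean total \<open>2 n l\<close>, at least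
  \<open>2 n\<close>, which leaves a margin of \<open>n\<close>. The conditional expectation in the
  assumption is almost surely at least -2, so the assumption yields
  \<open>E[L' - L] >= \<epsilon> / 2\<close> for large \<open>n\<close>, and it is in this form that
  it enters the covariance.\<close>

fun concat_blocks :: "nat \<Rightarrow> nat list \<Rightarrow> nat list" where
  "concat_blocks s [] = []"
| "concat_blocks s (x # w) = replicate x (s mod 2) @ concat_blocks (Suc s) w"

text \<open>Finite counterpart of \<open>blocks\<close>. A block of length 0 behind an exactly
  filled prefix is still taken, in agreement with the maximum in \<open>num_blocks\<close>.\<close>

fun full_blocks :: "nat \<Rightarrow> nat list \<Rightarrow> nat list" where
  "full_blocks n [] = []"
| "full_blocks n (x # w) = (if x \<le> n then x # full_blocks (n - x) w else [])"

lemma length_concat_blocks [simp]: "length (concat_blocks s w) = sum_list w"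
  by (induction w arbitrary: s) auto

lemma concat_blocks_append:
  "concat_blocks s (u @ v) = concat_blocks s u @ concat_blocks (s + length u) v"
  by (induction u arbitrary: s) auto

text \<open>A position beyond block 0 has least covering index at least 1, so dropping block 0
  lowers the index by one, which the advanced symbol counter makes up for. The second assumption
  supplies a covering block, so that the least index exists.\<close>

lemma block_seq_shift:
  assumes "b 0 \<le> i" "i < (\<Sum>j\<le>k. b j)"
  shows "block_seq s b i = block_seq (Suc s) (\<lambda>j. b (Suc j)) (i - b 0)"
proof -
  have "(LEAST k. i < (\<Sum>j\<le>k. b j)) = Suc (LEAST k. i < (\<Sum>j\<le>Suc k. b j))"
    by (rule Least_Suc[of _ k]) (use assms in auto)
  also have "(\<lambda>k. i < (\<Sum>j\<le>Suc k. b j)) = (\<lambda>k. i - b 0 < (\<Sum>j\<le>k. b (Suc j)))"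
    using assms(1) by (auto simp: sum.atMost_Suc_shift simp del: sum.atMost_Suc)
  finally show ?thesis by (simp add: block_seq_def)
qed

text \<open>Passage from infinite sequences to words: the first \<open>length w\<close> blocks cover
  all positions below \<open>n\<close>. As \<open>b\<close> is constrained on that range alone, the
  same bridge serves the original and the modified lengths.\<close>

lemma block_string_eq_take:
  assumes "n \<le> sum_list w" "\<And>k. k < length w \<Longrightarrow> b k = w ! k"
  shows "block_string s b n = take n (concat_blocks s w)"
  using assms
proof (induction w arbitrary: s b n)
  case Nil
  then show ?case by (simp add: block_string_def)
next
  case (Cons x w)
  have b0: "b 0 = x" using Cons.prems(2)[of 0] by simp
  have low: "block_seq s b i = s mod 2" if "i < x" for i
  proof -
    have "(LEAST k. i < (\<Sum>j\<le>k. b j)) = 0"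
      by (rule Least_eq_0) (simp add: b0 that)
    then show ?thesis by (simp add: block_seq_def)
  qed
  have S: "(\<Sum>j\<le>length w. b j) = x + sum_list w"
  proof -
    have "(\<Sum>j\<le>length w. b j) = (\<Sum>j<length (x # w). (x # w) ! j)"
      using Cons.prems(2) by (intro sum.cong) auto
    also have "\<dots> = sum_list (x # w)"
      by (simp only: sum_list_sum_nth lessThan_atLeast0)
    finally show ?thesis by simp
  qed
  show ?case
  proof (cases "n \<le> x")
    case True
    have "block_string s b n = map (\<lambda>i. s mod 2) [0..<n]"
      unfolding block_string_def using True low by (intro map_cong) auto
    then show ?thesis using True by (simp add: map_replicate_const)
  next
    case False
    have hi: "block_seq s b i = block_seq (Suc s) (\<lambda>j. b (Suc j)) (i - x)" if "x \<le> i" "i < n" for i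
      using block_seq_shift[of b i "length w" s] that b0 S Cons.prems(1) by auto
    have "block_string s b n = map (block_seq s b) [0..<x] @ map (block_seq s b) [x..<n]"
      unfolding block_string_def using False
      by (metis le_add_diff_inverse map_append nat_le_linear upt_add_eq_append zero_le)
    also have "map (block_seq s b) [0..<x] = replicate x (s mod 2)"
      using low by (intro nth_equalityI) auto
    also have "map (block_seq s b) [x..<n] = block_string (Suc s) (\<lambda>j. b (Suc j)) (n - x)"
      unfolding block_string_def using hi by (intro nth_equalityI) auto
    also have "\<dots> = take (n - x) (concat_blocks (Suc s) w)"
      using Cons.prems by (intro Cons.IH) auto
    finally show ?thesis using False by simp
  qed
qed

lemma sum_full_blocks_le: "sum_list (full_blocks n w) \<le> n"
proof (induction w arbitrary: n)
  case (Cons x w)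
  have "sum_list (full_blocks (n - x) w) \<le> n - x" by (rule Cons.IH)
  then show ?case by (cases "x \<le> n") auto
qed simp

text \<open>Together with \<open>full_blocks_decomp\<close> this characterises the full blocks: a
  prefix that fits and is followed by an overshooting block or by nothing.\<close>

lemma full_blocks_append:
  assumes "sum_list u \<le> n" "r = [] \<or> n < sum_list u + hd r"
  shows "full_blocks n (u @ r) = u"
  using assms
proof (induction u arbitrary: n)
  case Nil
  then show ?case by (cases r) auto
next
  case (Cons a u)
  have "full_blocks (n - a) (u @ r) = u"
    by (rule Cons.IH) (use Cons.prems in auto)
  then show ?case using Cons.prems by simp
qed

lemma full_blocks_decomp:
  obtains r where "w = full_blocks n w @ r" "r = [] \<or> n < sum_list (full_blocks n w) + hd r"
proof -
  have "\<exists>r. w = full_blocks n w @ r \<and> (r = [] \<or> n < sum_list (full_blocks n w) + hd r)"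
  proof (induction w arbitrary: n)
    case (Cons a w)
    obtain r where "w = full_blocks (n - a) w @ r"
      "r = [] \<or> n - a < sum_list (full_blocks (n - a) w) + hd r"
      using Cons.IH by blast
    then show ?case by (cases "a \<le> n") auto
  qed simp
  then show ?thesis using that by blast
qed

lemma full_blocks_decomp_Cons:
  assumes "n < sum_list w"
  obtains x r where "w = full_blocks n w @ x # r" "n < sum_list (full_blocks n w) + x"
proof -
  obtain r where r: "w = full_blocks n w @ r" "r = [] \<or> n < sum_list (full_blocks n w) + hd r"
    by (rule full_blocks_decomp)
  have "r \<noteq> []" using r(1) assms sum_full_blocks_le[of n w] by auto
  then show ?thesis using r that[of "hd r" "tl r"] by auto
qed

lemma length_full_blocks_le: "length (full_blocks n w) \<le> length w"
  by (induction w arbitrary: n) auto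

lemma length_full_blocks_less: "n < sum_list w \<Longrightarrow> length (full_blocks n w) < length w"
proof -
  assume "n < sum_list w"
  then obtain x r where "w = full_blocks n w @ x # r" by (rule full_blocks_decomp_Cons)
  then have "length w = length (full_blocks n w) + length (x # r)" by (metis length_append)
  then show ?thesis by simp
qed

text \<open>The cut rest shows only the symbol of the overshooting block, never its full length, so
  a block of any length at least \<open>n\<close> pads the string just as well. Hence the visible
  string is a function of the first symbol and the full blocks.\<close>

lemma take_concat_full_blocks:
  assumes "n \<le> sum_list w" "n \<le> m"
  shows "take n (concat_blocks s w) = take n (concat_blocks s (full_blocks n w @ [m]))"
  using assms
proof (induction w arbitrary: n s)
  case (Cons x w)
  show ?case
  proof (cases "x \<le> n")
    case True
    then show ?thesis using Cons.IH[of "n - x" "Suc s"] Cons.prems by simp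
  qed (use Cons.prems in \<open>simp add: min_def\<close>)
qed simp

text \<open>The strict inequality places the overshooting block inside \<open>w\<close>, so no block
  behind \<open>w\<close> can belong to the count.\<close>

lemma blocks_eq_full_blocks:
  assumes "n < sum_list w" "\<And>k. k < length w \<Longrightarrow> b k = w ! k"
  shows "blocks b n = full_blocks n w"
proof -
  let ?t = "length (full_blocks n w)"
  obtain x r where r: "w = full_blocks n w @ x # r" "n < sum_list (full_blocks n w) + x"
    by (rule full_blocks_decomp_Cons[OF assms(1)])
  have t: "?t < length w" by (rule length_full_blocks_less[OF assms(1)])
  have bk: "b k = full_blocks n w ! k" if "k < ?t" for k
  proof -
    have "w ! k = full_blocks n w ! k" by (metis r(1) nth_append that)
    then show ?thesis using assms(2)[of k] t that by simp
  qed
  have "w ! ?t = x" by (metis r(1) nth_append_length)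
  then have bt: "b ?t = x" using assms(2)[of ?t] t by simp
  have St: "(\<Sum>j<?t. b j) = sum_list (full_blocks n w)"
    using bk by (simp add: sum_list_sum_nth lessThan_atLeast0)
  have "{k. (\<Sum>j<k. b j) \<le> n} = {..?t}"
  proof (intro equalityI subsetI; simp)
    fix k assume k: "(\<Sum>j<k. b j) \<le> n"
    show "k \<le> ?t"
    proof (rule ccontr)
      assume "\<not> k \<le> ?t"
      then have "(\<Sum>j<Suc ?t. b j) \<le> (\<Sum>j<k. b j)" by (intro sum_mono2) auto
      then show False using k St bt r(2) by simp
    qed
  next
    fix k assume "k \<le> ?t"
    then have "(\<Sum>j<k. b j) \<le> (\<Sum>j<?t. b j)" by (intro sum_mono2) auto
    then show "(\<Sum>j<k. b j) \<le> n" using St sum_full_blocks_le[of n w] by simp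
  qed
  then have "num_blocks b n = ?t" unfolding num_blocks_def by (auto intro: Max_eqI)
  then show ?thesis unfolding blocks_def using bk by (intro nth_equalityI) auto
qed

text \<open>The first block of positive length displays the parity of the starting symbol plus its
  index; empty blocks before it shift both sides alike, and the padding block \<open>n > 0\<close>
  guarantees that such a block exists. This recovers the first symbol from the visible string and
  its blocks.\<close>

lemma concat_blocks_symbol_inj:
  assumes "n > 0" "take n (concat_blocks s (u @ [n])) = take n (concat_blocks s' (u @ [n]))"
  shows "s mod 2 = s' mod 2"
proof -
  have "s mod 2 = s' mod 2" if "v \<noteq> []" "last v > 0"
    "take n (concat_blocks s v) = take n (concat_blocks s' v)" for v
    using that
  proof (induction v arbitrary: s s' rule: list.induct)
    case Nil
    then show ?case by simp
  next
    case (Cons x v)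
    show ?case
    proof (cases "x = 0")
      case True
      then have "v \<noteq> []" using Cons.prems(2) by auto
      then have "Suc s mod 2 = Suc s' mod 2"
        using True Cons.prems by (intro Cons.IH) simp_all
      then show ?thesis by presburger
    next
      case False
      then show ?thesis using Cons.prems(3) assms(1) by simp
    qed
  qed
  from this[of "u @ [n]"] show ?thesis using assms by simp
qed

section \<open>Common subsequences under insertion and deletion of runs\<close>

lemma finite_common_subseqs: "finite {length z | z. subseq z x \<and> subseq z y}"
proof (rule finite_subset)
  show "{length z | z. subseq z x \<and> subseq z y} \<subseteq> {..length x}"
    by (auto dest: list_emb_length)
qed simp

lemma lcs_ge: "subseq z x \<Longrightarrow> subseq z y \<Longrightarrow> length z \<le> lcs x y"
  unfolding lcs_def using finite_common_subseqs by (intro Max_ge) auto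

lemma lcs_witness:
  obtains z where "subseq z x" "subseq z y" "lcs x y = length z"
proof -
  have "{length z | z. subseq z x \<and> subseq z y} \<noteq> {}"
    by (auto intro: exI[of _ "[]"])
  from Max_in[OF finite_common_subseqs this] show ?thesis
    using that unfolding lcs_def by auto
qed

lemma lcs_le_length: "lcs x y \<le> length x"
proof -
  obtain z where "subseq z x" "lcs x y = length z" by (rule lcs_witness)
  then show ?thesis by (simp add: list_emb_length)
qed

lemma lcs_commute: "lcs x y = lcs y x"
  unfolding lcs_def by (simp add: conj_commute)

text \<open>Inclusion-exclusion on positions: two sets of selected positions of \<open>x\<close>
  meet in at least \<open>length z + length u - length x\<close> places, and the symbols there form
  \<open>v\<close>.\<close>

lemma subseq_common:
  assumes "subseq z x" "subseq u x"
  shows "\<exists>v. subseq v z \<and> subseq v u \<and> length z + length u \<le> length v + length x"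
  using assms
proof (induction x arbitrary: z u rule: list.induct)
  case Nil
  then show ?case by auto
next
  case (Cons a x)
  consider (1) "subseq z x" "subseq u x"
    | (2) u' where "u = a # u'" "subseq z x" "subseq u' x"
    | (3) z' where "z = a # z'" "subseq z' x" "subseq u x"
    | (4) z' u' where "z = a # z'" "u = a # u'" "subseq z' x" "subseq u' x"
    using Cons.prems by (cases z; cases u) (auto split: if_splits)
  then show ?case
  proof cases
    case 1
    then obtain v where "subseq v z" "subseq v u" "length z + length u \<le> length v + length x"
      using Cons.IH by blast
    then show ?thesis by (intro exI[of _ v]) auto
  next
    case 2
    then obtain v where "subseq v z" "subseq v u'" "length z + length u' \<le> length v + length x"
      using Cons.IH by blast
    then show ?thesis using 2 by (intro exI[of _ v]) auto
  next
    case 3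
    then obtain v where "subseq v z'" "subseq v u" "length z' + length u \<le> length v + length x"
      using Cons.IH by blast
    then show ?thesis using 3 by (intro exI[of _ v]) auto
  next
    case 4
    then obtain v where "subseq v z'" "subseq v u'" "length z' + length u' \<le> length v + length x"
      using Cons.IH by blast
    then show ?thesis using 4 by (intro exI[of _ "a # v"]) auto
  qed
qed

text \<open>Passing from \<open>x\<close> to \<open>u\<close> deletes at most \<open>d\<close>
  symbols, hence destroys at most \<open>d\<close> symbols of an optimal common subsequence; what
  survives lies in \<open>x'\<close> as well.\<close>

lemma lcs_le_of_common_subseq:
  assumes "subseq u x" "subseq u x'" "length x \<le> length u + d"
  shows "lcs x y \<le> lcs x' y + d"
proof -
  obtain z where z: "subseq z x" "subseq z y" "lcs x y = length z" by (rule lcs_witness)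
  obtain v where v: "subseq v z" "subseq v u" "length z + length u \<le> length v + length x"
    using subseq_common[OF z(1) assms(1)] by blast
  have "length v \<le> lcs x' y"
    by (intro lcs_ge subseq_order.trans[OF v(2) assms(2)] subseq_order.trans[OF v(1) z(2)])
  then show ?thesis using v(3) z(3) assms(3) by linarith
qed

lemma subseq_take_insert: "subseq (take m (p @ r)) (take (m + length q) (p @ q @ r))"
proof (cases "m \<le> length p")
  case True
  then have "take m (p @ r) = take m (take (m + length q) (p @ q @ r))" by simp
  then show ?thesis by (simp only: prefix_imp_subseq take_is_prefix)
next
  case False
  then have "take (m + length q) (p @ q @ r) = p @ q @ take (m - length p) r" by simp
  moreover have "subseq (p @ v) (p @ q @ v)" for v
    by (intro list_emb_append_mono subseq_order.refl list_emb_append2)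
  ultimately show ?thesis using False by simp
qed

text \<open>An insertion pushes at most \<open>length q\<close> symbols over the cut at
  \<open>n\<close>, so both truncated strings contain the first \<open>n - length q\<close> symbols
  of \<open>p @ r\<close>. Truncation therefore costs nothing beyond the insertion itself.\<close>

lemma lcs_take_insert:
  assumes "length q \<le> d"
  shows "\<bar>int (lcs (take n (p @ q @ r)) y) - int (lcs (take n (p @ r)) y)\<bar> \<le> int d"
proof -
  let ?u = "take (n - length q) (p @ r)"
  have 1: "subseq ?u (take n (p @ r))"
  proof -
    have "?u = take (n - length q) (take n (p @ r))" by (simp add: min_def)
    then show ?thesis by (simp only: prefix_imp_subseq take_is_prefix)
  qed
  have 2: "subseq ?u (take n (p @ q @ r))"
  proof (cases "length q \<le> n")
    case True
    then show ?thesis using subseq_take_insert[of "n - length q" p r q] by simp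
  qed simp
  have "lcs (take n (p @ q @ r)) y \<le> lcs (take n (p @ r)) y + d"
    by (rule lcs_le_of_common_subseq[OF 2 1]) (use assms in auto)
  moreover have "lcs (take n (p @ r)) y \<le> lcs (take n (p @ q @ r)) y + d"
    by (rule lcs_le_of_common_subseq[OF 1 2]) (use assms in auto)
  ultimately show ?thesis by linarith
qed

text \<open>Symbols alternate by block index, not by length, so the blocks behind block
  \<open>k\<close> keep their symbols and lengthening block \<open>k\<close> merely inserts a
  run.\<close>

lemma lcs_block_update:
  assumes "k < length w" "x \<le> w ! k + d" "w ! k \<le> x + d"
  shows "\<bar>int (lcs (take n (concat_blocks s (w[k := x]))) y)
    - int (lcs (take n (concat_blocks s w)) y)\<bar> \<le> int d"
proof -
  have dec: "concat_blocks s (w[k := z]) = concat_blocks s (take k w)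
      @ replicate z ((s + k) mod 2) @ concat_blocks (Suc (s + k)) (drop (Suc k) w)" for z
    using assms(1) by (simp add: upd_conv_take_nth_drop concat_blocks_append min_def)
  have *: "\<bar>int (lcs (take n (concat_blocks s (w[k := z + e]))) y)
    - int (lcs (take n (concat_blocks s (w[k := z]))) y)\<bar> \<le> int e" for z e
  proof -
    let ?p = "concat_blocks s (take k w) @ replicate z ((s + k) mod 2)"
    let ?r = "concat_blocks (Suc (s + k)) (drop (Suc k) w)"
    have 1: "concat_blocks s (w[k := z + e]) = ?p @ replicate e ((s + k) mod 2) @ ?r"
      unfolding dec by (simp only: replicate_add append_assoc)
    have 2: "concat_blocks s (w[k := z]) = ?p @ ?r"
      unfolding dec by (simp only: append_assoc)
    show ?thesis unfolding 1 2 by (rule lcs_take_insert) simp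
  qed
  show ?thesis
  proof (cases "w ! k \<le> x")
    case True
    then have e: "w ! k + (x - w ! k) = x" and "x - w ! k \<le> d" using assms by auto
    then show ?thesis using *[of "w ! k" "x - w ! k"] unfolding e list_update_id by linarith
  next
    case False
    then have e: "x + (w ! k - x) = w ! k" and "w ! k - x \<le> d" using assms by auto
    then show ?thesis using *[of x "w ! k - x"] unfolding e list_update_id by linarith
  qed
qed

text \<open>Moving the first block to the end while advancing the symbol counter leaves the symbol
  of every other block unchanged; both strings arise from \<open>?v\<close> by adding one run of
  length at most \<open>d\<close>. This is the device for comparing the two possible first
  symbols.\<close>

lemma lcs_rotate_blocks:
  assumes "x \<le> d"
  shows "\<bar>int (lcs (take n (concat_blocks (Suc s) (w @ [x]))) y)
    - int (lcs (take n (concat_blocks s (x # w))) y)\<bar> \<le> 2 * int d"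
proof -
  let ?v = "concat_blocks (Suc s) w"
  have 1: "\<bar>int (lcs (take n (?v @ replicate x c)) y) - int (lcs (take n ?v) y)\<bar> \<le> int d" for c
    using lcs_take_insert[of "replicate x c" d n ?v "[]" y] assms
    by (simp only: append_Nil2 length_replicate)
  have 2: "\<bar>int (lcs (take n (replicate x c @ ?v)) y) - int (lcs (take n ?v) y)\<bar> \<le> int d" for c
    using lcs_take_insert[of "replicate x c" d n "[]" ?v y] assms
    by (simp only: append_Nil length_replicate)
  show ?thesis
    using 1[of "(Suc s + length w) mod 2"] 2[of "s mod 2"]
    unfolding concat_blocks_append concat_blocks.simps append_Nil2 by linarith
qed

section \<open>Averages over words\<close>

definition words :: "'b set \<Rightarrow> nat \<Rightarrow> 'b list set" where
  "words V K = {w. set w \<subseteq> V \<and> length w = K}"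

definition word_avg :: "'b set \<Rightarrow> nat \<Rightarrow> ('b list \<Rightarrow> real) \<Rightarrow> real" where
  "word_avg V K f = (\<Sum>w\<in>words V K. f w) / real (card V) ^ K"

lemma finite_words: "finite V \<Longrightarrow> finite (words V K)"
  unfolding words_def by (rule finite_lists_length_eq)

lemma card_words: "finite V \<Longrightarrow> card (words V K) = card V ^ K"
  unfolding words_def by (rule card_lists_length_eq)

lemma words_0: "words V 0 = {[]}"
  by (auto simp: words_def)

lemma words_Suc: "words V (Suc K) = (\<lambda>(x, w). x # w) ` (V \<times> words V K)"
  by (auto simp: words_def length_Suc_conv image_iff)

lemma word_avg_0: "word_avg V 0 f = f []"
  by (simp add: word_avg_def words_0)

text \<open>Conditioning on the first letter. The moment bounds on words are inductions along this
  identity.\<close>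

lemma word_avg_Suc:
  "word_avg V (Suc K) f = (\<Sum>x\<in>V. word_avg V K (\<lambda>w. f (x # w))) / real (card V)"
proof -
  have "(\<Sum>w\<in>words V (Suc K). f w) = (\<Sum>(x, w)\<in>V \<times> words V K. f (x # w))"
    unfolding words_Suc by (subst sum.reindex) (auto simp: inj_on_def case_prod_unfold)
  also have "\<dots> = (\<Sum>x\<in>V. \<Sum>w\<in>words V K. f (x # w))"
    by (rule sum.cartesian_product[symmetric])
  finally show ?thesis
    by (simp add: word_avg_def sum_divide_distrib[symmetric] field_simps)
qed

lemma word_avg_add: "word_avg V K (\<lambda>w. f w + g w) = word_avg V K f + word_avg V K g"
  by (simp add: word_avg_def sum.distrib add_divide_distrib)

lemma word_avg_diff: "word_avg V K (\<lambda>w. f w - g w) = word_avg V K f - word_avg V K g"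
  by (simp add: word_avg_def sum_subtractf diff_divide_distrib)

lemma word_avg_cmult: "word_avg V K (\<lambda>w. c * f w) = c * word_avg V K f"
  by (simp add: word_avg_def sum_distrib_left[symmetric])

lemma word_avg_const: "finite V \<Longrightarrow> V \<noteq> {} \<Longrightarrow> word_avg V K (\<lambda>w. c) = c"
  by (simp add: word_avg_def card_words)

lemma word_avg_mono: "(\<And>w. w \<in> words V K \<Longrightarrow> f w \<le> g w) \<Longrightarrow> word_avg V K f \<le> word_avg V K g"
  by (simp add: word_avg_def divide_right_mono sum_mono)

lemma word_avg_cong: "(\<And>w. w \<in> words V K \<Longrightarrow> f w = g w) \<Longrightarrow> word_avg V K f = word_avg V K g"
  by (simp add: word_avg_def cong: sum.cong)

lemma word_avg_abs_le:
  assumes "finite V" "V \<noteq> {}" "\<And>w. w \<in> words V K \<Longrightarrow> \<bar>f w - g w\<bar> \<le> c"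
  shows "\<bar>word_avg V K f - word_avg V K g\<bar> \<le> c"
proof -
  have "word_avg V K (\<lambda>w. f w - g w) \<le> word_avg V K (\<lambda>w. c)"
    using assms(3) by (intro word_avg_mono) (simp add: abs_le_iff)
  moreover have "word_avg V K (\<lambda>w. - c) \<le> word_avg V K (\<lambda>w. f w - g w)"
    using assms(3) by (intro word_avg_mono) (smt (verit) abs_le_iff)
  ultimately show ?thesis using assms(1,2) by (simp add: word_avg_const word_avg_diff abs_le_iff)
qed

text \<open>Bias-variance decomposition. With a conditional mean as \<open>word_avg V K f\<close>
  and the overall mean as \<open>c\<close> it acts as the law of total variance.\<close>

lemma word_avg_second_moment_shift:
  assumes "finite V" "V \<noteq> {}"
  shows "word_avg V K (\<lambda>w. (f w - c)\<^sup>2)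
    = word_avg V K (\<lambda>w. (f w - word_avg V K f)\<^sup>2) + (word_avg V K f - c)\<^sup>2"
proof -
  have "word_avg V K (\<lambda>w. (f w - c)\<^sup>2) = word_avg V K (\<lambda>w. f w * f w) - 2 * c * word_avg V K f + c\<^sup>2" for c
  proof -
    have "word_avg V K (\<lambda>w. (f w - c)\<^sup>2) = word_avg V K (\<lambda>w. (f w * f w - 2 * c * f w) + c\<^sup>2)"
      by (rule word_avg_cong) (simp add: power2_eq_square algebra_simps)
    also have "\<dots> = word_avg V K (\<lambda>w. f w * f w) - 2 * c * word_avg V K f + c\<^sup>2"
      using assms by (simp add: word_avg_add word_avg_diff word_avg_cmult word_avg_const)
    finally show ?thesis .
  qed
  from this[of c] this[of "word_avg V K f"] show ?thesis
    by (simp add: power2_eq_square algebra_simps)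
qed

text \<open>By total variance, each letter contributes the variance of its conditional mean, and the
  conditional means for two values of the letter differ by at most \<open>c\<close>.\<close>

lemma word_avg_bounded_diff_variance:
  assumes V: "finite V" "V \<noteq> {}"
    and diff: "\<And>w k x. w \<in> words V K \<Longrightarrow> k < K \<Longrightarrow> x \<in> V \<Longrightarrow> \<bar>f (w[k := x]) - f w\<bar> \<le> c"
  shows "word_avg V K (\<lambda>w. (f w - word_avg V K f)\<^sup>2) \<le> real K * c\<^sup>2"
  using diff
proof (induction K arbitrary: f)
  case 0
  then show ?case by (simp add: word_avg_0)
next
  case (Suc K)
  have cV: "real (card V) > 0" using V by (simp add: card_gt_0_iff)
  let ?m = "word_avg V (Suc K) f"
  let ?g = "\<lambda>x. word_avg V K (\<lambda>w. f (x # w))"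
  have IH: "word_avg V K (\<lambda>w. (f (x # w) - ?g x)\<^sup>2) \<le> real K * c\<^sup>2" if "x \<in> V" for x
  proof (rule Suc.IH)
    fix w k y assume "w \<in> words V K" "k < K" "y \<in> V"
    then show "\<bar>f (x # w[k := y]) - f (x # w)\<bar> \<le> c"
      using Suc.prems[of "x # w" "Suc k" y] that by (simp add: words_def)
  qed
  have gg: "\<bar>?g x - ?g y\<bar> \<le> c" if "x \<in> V" "y \<in> V" for x y
  proof (rule word_avg_abs_le[OF V])
    fix w assume "w \<in> words V K"
    then show "\<bar>f (x # w) - f (y # w)\<bar> \<le> c"
      using Suc.prems[of "y # w" 0 x] that by (simp add: words_def)
  qed
  have gm: "(?g x - ?m)\<^sup>2 \<le> c\<^sup>2" if "x \<in> V" for x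
  proof -
    \<comment> \<open>Multiplying by the number of letters writes the deviation from the mean as a
      sum of pairwise differences, each at most \<open>c\<close> in absolute value.\<close>
    have "card V * (?g x - ?m) = (\<Sum>y\<in>V. ?g x - ?g y)"
      using cV by (simp add: word_avg_Suc sum_subtractf right_diff_distrib)
    also have "\<bar>\<dots>\<bar> \<le> (\<Sum>y\<in>V. c)"
      using gg that by (intro order_trans[OF sum_abs] sum_mono) auto
    finally have "card V * \<bar>?g x - ?m\<bar> \<le> card V * c" by (simp add: abs_mult)
    then have "\<bar>?g x - ?m\<bar> \<le> c" using cV by simp
    then show ?thesis using power_mono[of "\<bar>?g x - ?m\<bar>" c 2] by simp
  qed
  have "word_avg V (Suc K) (\<lambda>w. (f w - ?m)\<^sup>2)
      = (\<Sum>x\<in>V. word_avg V K (\<lambda>w. (f (x # w) - ?m)\<^sup>2)) / card V"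
    by (rule word_avg_Suc)
  also have "\<dots> \<le> (\<Sum>x\<in>V. real K * c\<^sup>2 + c\<^sup>2) / card V"
    by (intro divide_right_mono sum_mono)
      (subst word_avg_second_moment_shift[OF V], use IH gm in \<open>auto intro!: add_mono\<close>)
  also have "\<dots> = real (Suc K) * c\<^sup>2" using cV by (simp add: field_simps)
  finally show ?case .
qed

lemma word_avg_rotate:
  assumes "finite V"
  shows "word_avg V (Suc K) (\<lambda>w. f (tl w @ [hd w])) = word_avg V (Suc K) f"
proof -
  have tl: "tl w @ [hd w] \<in> words V (Suc K)" "last (tl w @ [hd w]) # butlast (tl w @ [hd w]) = w"
    if "w \<in> words V (Suc K)" for w
    using that by (cases w; auto simp: words_def)+
  have bl: "last w # butlast w \<in> words V (Suc K)"
    "tl (last w # butlast w) @ [hd (last w # butlast w)] = w"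
    if "w \<in> words V (Suc K)" for w
    using that by (cases w rule: rev_cases; auto simp: words_def)+
  have "(\<Sum>w\<in>words V (Suc K). f (tl w @ [hd w])) = (\<Sum>w\<in>words V (Suc K). f w)"
    by (rule sum.reindex_bij_witness[of _ "\<lambda>w. last w # butlast w" "\<lambda>w. tl w @ [hd w]"])
      (use tl bl in auto)
  then show ?thesis by (simp add: word_avg_def)
qed

text \<open>The overshooting block is included. The number of summands is then a stopping time,
  whereas the number of full blocks is not: it looks one block ahead.\<close>

fun stopped_sum :: "(nat \<Rightarrow> real) \<Rightarrow> nat \<Rightarrow> nat list \<Rightarrow> real" where
  "stopped_sum f n [] = 0"
| "stopped_sum f n (x # w) = f x + (if x \<le> n then stopped_sum f (n - x) w else 0)"

lemma stopped_sum_eq: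
  "stopped_sum f n w = sum_list (map f (full_blocks n w))
    + (if n < sum_list w then f (w ! length (full_blocks n w)) else 0)"
  by (induction w arbitrary: n) (auto simp: less_diff_conv2)

text \<open>Wald's identity for centred summands: a block counts or not according to the earlier
  blocks alone, so its conditional mean is zero. The end of the word stops the sum as well.\<close>

lemma word_avg_stopped_sum:
  assumes V: "finite V" "V \<noteq> {}" and f: "(\<Sum>x\<in>V. f x) = 0"
  shows "word_avg V K (stopped_sum f n) = 0"
proof (induction K arbitrary: n)
  case 0
  then show ?case by (simp add: word_avg_0)
next
  case (Suc K)
  have "word_avg V K (\<lambda>w. stopped_sum f n (x # w)) = f x" for x
    using Suc.IH[of "n - x"] by (cases "x \<le> n") (simp_all add: word_avg_add word_avg_const[OF V])
  then show ?case using f by (simp add: word_avg_Suc)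
qed

text \<open>Whether a summand is counted depends only on the earlier blocks, so the summands are
  orthogonal.\<close>

lemma word_avg_stopped_sum_square:
  assumes V: "finite V" "V \<noteq> {}" and f: "(\<Sum>x\<in>V. f x) = 0" and c: "\<And>x. x \<in> V \<Longrightarrow> \<bar>f x\<bar> \<le> c"
  shows "word_avg V K (\<lambda>w. (stopped_sum f n w)\<^sup>2) \<le> real K * c\<^sup>2"
proof (induction K arbitrary: n)
  case 0
  then show ?case by (simp add: word_avg_0)
next
  case (Suc K)
  have cV: "real (card V) > 0" using V by (simp add: card_gt_0_iff)
  have "word_avg V K (\<lambda>w. (stopped_sum f n (x # w))\<^sup>2) \<le> c\<^sup>2 + real K * c\<^sup>2" if "x \<in> V" for x
  proof -
    have fx: "(f x)\<^sup>2 \<le> c\<^sup>2" using power_mono[of "\<bar>f x\<bar>" c 2] c[OF that] by simp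
    show ?thesis
    proof (cases "x \<le> n")
      case True
      have "word_avg V K (\<lambda>w. (stopped_sum f n (x # w))\<^sup>2)
        = word_avg V K (\<lambda>w. (f x)\<^sup>2 + 2 * f x * stopped_sum f (n - x) w + (stopped_sum f (n - x) w)\<^sup>2)"
        using True by (intro word_avg_cong) (simp add: power2_sum)
      also have "\<dots> = (f x)\<^sup>2 + word_avg V K (\<lambda>w. (stopped_sum f (n - x) w)\<^sup>2)"
        using word_avg_stopped_sum[OF V f, of K "n - x"]
        by (simp add: word_avg_add word_avg_cmult word_avg_const[OF V])
      finally show ?thesis using fx Suc.IH[of "n - x"] by simp
    next
      case False
      then show ?thesis using fx by (simp add: word_avg_const[OF V] add_increasing2)
    qed
  qed
  then have "word_avg V (Suc K) (\<lambda>w. (stopped_sum f n w)\<^sup>2) \<le> (\<Sum>x\<in>V. c\<^sup>2 + real K * c\<^sup>2) / card V"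
    unfolding word_avg_Suc by (intro divide_right_mono sum_mono) auto
  also have "\<dots> = real (Suc K) * c\<^sup>2" using cV by (simp add: field_simps)
  finally show ?case .
qed

text \<open>The sum over the full blocks omits the overshooting block, which is the last summand of
  the stopped sum; this is the only discrepancy.\<close>

lemma sum_list_full_blocks_approx:
  assumes "n < sum_list w" "\<And>x. x \<in> set w \<Longrightarrow> \<bar>f x\<bar> \<le> c"
  shows "\<bar>sum_list (map f (full_blocks n w))\<bar> \<le> \<bar>stopped_sum f n w\<bar> + c"
proof -
  have "\<bar>f (w ! length (full_blocks n w))\<bar> \<le> c"
    using length_full_blocks_less[OF assms(1)] by (intro assms(2)) auto
  then show ?thesis using assms(1) unfolding stopped_sum_eq by simp
qed

section \<open>Counting and changing blocks of a given length\<close>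

lemma finite_blocks_of_length [simp]: "finite (blocks_of_length m bs)"
  by (simp add: blocks_of_length_def)

lemma card_blocks_of_length_le: "card (blocks_of_length m bs) \<le> length bs"
proof -
  have "card (blocks_of_length m bs) \<le> card {..<length bs}"
    by (rule card_mono) (auto simp: blocks_of_length_def)
  then show ?thesis by simp
qed

lemma card_blocks_of_length:
  "real (card (blocks_of_length m bs)) = sum_list (map (\<lambda>x. if x = m then 1 else 0) bs)"
proof -
  have "real (length (filter (\<lambda>x. x = m) bs)) = sum_list (map (\<lambda>x. if x = m then 1 else 0) bs)"
    by (induction bs) auto
  then show ?thesis by (simp add: blocks_of_length_def length_filter_conv_card)
qed

text \<open>The two new lengths have the old total, so the altered prefix fills the same space and
  is followed by the same overshooting block: stopping and cut rest are untouched.\<close>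

lemma full_blocks_update2:
  assumes "i < length (full_blocks n w)" "j < length (full_blocks n w)" "i \<noteq> j"
    "x + y = w ! i + w ! j"
  shows "full_blocks n (w[i := x, j := y]) = (full_blocks n w)[i := x, j := y]"
    and "sum_list (w[i := x, j := y]) = sum_list w"
proof -
  obtain r where r: "w = full_blocks n w @ r" "r = [] \<or> n < sum_list (full_blocks n w) + hd r"
    by (rule full_blocks_decomp)
  let ?u = "full_blocks n w"
  have nth: "w ! i = ?u ! i" "w ! j = ?u ! j"
    using assms(1,2) r(1) by (metis nth_append)+
  \<comment> \<open>Two distinct entries together do not exceed the total, so the subtraction of
    natural numbers in the update formula for sums does not truncate.\<close>
  have le: "u ! i + u ! j \<le> sum_list u" if "i < length u" "j < length u" for u :: "nat list"
  proof -
    have "(\<Sum>k\<in>{i, j}. u ! k) \<le> (\<Sum>k<length u. u ! k)"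
      using that by (intro sum_mono2) auto
    then show ?thesis using assms(3) by (simp add: sum_list_sum_nth lessThan_atLeast0)
  qed
  have upd: "sum_list (u[i := x, j := y]) = sum_list u" 
    if "i < length u" "j < length u" "x + y = u ! i + u ! j" for u :: "nat list"
    using that assms(3) le[of u] by (simp add: sum_list_update)
  show "sum_list (w[i := x, j := y]) = sum_list w"
    using assms length_full_blocks_le[of n w] by (intro upd) auto
  have s: "sum_list (?u[i := x, j := y]) = sum_list ?u"
    using assms nth by (intro upd) auto
  have "w[i := x, j := y] = ?u[i := x, j := y] @ r"
    using assms(1,2) r(1) by (metis list_update_append1 length_list_update)
  then show "full_blocks n (w[i := x, j := y]) = ?u[i := x, j := y]"
    using full_blocks_append[of "?u[i := x, j := y]" n r] s r(2) sum_full_blocks_le[of n w] by simp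
qed

section \<open>Moments of the block counts\<close>

text \<open>Positivity of \<open>l\<close> keeps the three lengths distinct, as truncated
  subtraction would identify \<open>l - 1\<close> with \<open>l\<close> at 0.\<close>

lemma sum_three_lengths:
  assumes "l > (0::nat)"
  shows "(\<Sum>x\<in>{l - 1, l, l + 1}. f x) = f (l - 1) + (f l + (f (l + 1) :: real))"
proof -
  obtain k where "l = Suc k" using assms by (cases l) auto
  then show ?thesis by simp
qed

lemma list_update2_cancel:
  assumes "i \<noteq> j" "x = w ! i" "y = w ! j"
  shows "w[i := a, j := b, i := x, j := y] = w"
proof -
  have "w[i := a, j := b, i := x, j := y] = w[i := x, j := y]"
    by (metis assms(1) list_update_overwrite list_update_swap)
  then show ?thesis using assms(2,3) by simp
qed

lemma sum_list_map_diff_const: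
  "sum_list (map (\<lambda>x. real x - c) u) = real (sum_list u) - c * real (length u)"
  by (induction u) (auto simp: algebra_simps)

text \<open>Turning a block of length \<open>l - 1\<close> and one of length \<open>l + 1\<close> into blocks of length \<open>l\<close> is a
  bijection between the words with two such marked blocks and the words with two distinct marked
  blocks of length \<open>l\<close>.\<close>

lemma sum_modified_blocks:
  fixes G :: "nat list \<Rightarrow> real"
  assumes l: "l > 0" and V: "V = {l - 1, l, l + 1}"
  shows "(\<Sum>w | w \<in> words V K \<and> n < sum_list w.
      \<Sum>i\<in>blocks_of_length (l - 1) (full_blocks n w). \<Sum>j\<in>blocks_of_length (l + 1) (full_blocks n w).
        G ((full_blocks n w)[i := l, j := l]))
    = (\<Sum>w | w \<in> words V K \<and> n < sum_list w.
        real (card (blocks_of_length l (full_blocks n w)))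
          * (real (card (blocks_of_length l (full_blocks n w))) - 1) * G (full_blocks n w))"
proof -
  let ?W = "{w. w \<in> words V K \<and> n < sum_list w}"
  let ?B = "\<lambda>m w. blocks_of_length m (full_blocks n w)"
  \<comment> \<open>Ordered pairs of distinct places. A short and a long place differ of themselves,
    whereas two places of length \<open>l\<close> may coincide, so the diagonal is removed; this is
    the source of \<open>m (m - 1)\<close>.\<close>
  let ?D = "\<lambda>w. ?B l w \<times> ?B l w - (\<lambda>i. (i, i)) ` ?B l w"
  have fin: "finite ?W" using finite_words[of V K] V by simp
  have fb: "full_blocks n w ! i = w ! i" "i < length w" if "i < length (full_blocks n w)" for w i
  proof -
    show "full_blocks n w ! i = w ! i" by (metis full_blocks_decomp nth_append that)
    show "i < length w" using that length_full_blocks_le[of n w] by simp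
  qed
  have B: "i \<in> ?B m w \<longleftrightarrow> i < length (full_blocks n w) \<and> w ! i = m" for i m w
    unfolding blocks_of_length_def using fb by auto
  have upd: "w[i := x, j := y] \<in> ?W"
    "full_blocks n (w[i := x, j := y]) = (full_blocks n w)[i := x, j := y]"
    if "w \<in> ?W" "i < length (full_blocks n w)" "j < length (full_blocks n w)" "i \<noteq> j"
      "x + y = w ! i + w ! j" "x \<in> V" "y \<in> V" for w i j x y
    using full_blocks_update2[OF that(2-5)] that(1,6,7)
    by (auto simp: words_def dest!: subsetD[OF set_update_subset_insert])
  have "(\<Sum>w\<in>?W. \<Sum>i\<in>?B (l - 1) w. \<Sum>j\<in>?B (l + 1) w. G ((full_blocks n w)[i := l, j := l]))
      = (\<Sum>(w, i, j)\<in>Sigma ?W (\<lambda>w. ?B (l - 1) w \<times> ?B (l + 1) w). G ((full_blocks n w)[i := l, j := l]))"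
    using fin by (simp add: sum.Sigma sum.cartesian_product case_prod_unfold)
  also have "\<dots> = (\<Sum>(w, i, j)\<in>Sigma ?W ?D. G (full_blocks n w))"
  proof (rule sum.reindex_bij_witness[of _ "\<lambda>(w, i, j). (w[i := l - 1, j := l + 1], i, j)"
        "\<lambda>(w, i, j). (w[i := l, j := l], i, j)"])
    fix p assume "p \<in> Sigma ?W (\<lambda>w. ?B (l - 1) w \<times> ?B (l + 1) w)"
    then obtain w i j where p: "p = (w, i, j)" "w \<in> ?W" "i \<in> ?B (l - 1) w" "j \<in> ?B (l + 1) w"
      by auto
    have ij: "i < length (full_blocks n w)" "j < length (full_blocks n w)" "w ! i = l - 1" "w ! j = l + 1"
      using p(3,4) by (auto simp: B)
    have ne: "i \<noteq> j" using ij(3,4) by auto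
    have eq: "l + l = w ! i + w ! j" using ij(3,4) l by simp
    note u = upd[OF p(2) ij(1,2) ne eq]
    show "(case case p of (w, i, j) \<Rightarrow> (w[i := l, j := l], i, j) of
        (w, i, j) \<Rightarrow> (w[i := l - 1, j := l + 1], i, j)) = p"
      using p(1) list_update2_cancel[OF ne ij(3)[symmetric] ij(4)[symmetric]] by simp
    show "(case p of (w, i, j) \<Rightarrow> (w[i := l, j := l], i, j)) \<in> Sigma ?W ?D"
      using u V ij(1,2) fb(2)[OF ij(1)] fb(2)[OF ij(2)] ne p(1)
      by (auto simp: blocks_of_length_def nth_list_update)
    show "(case case p of (w, i, j) \<Rightarrow> (w[i := l, j := l], i, j) of (w, i, j) \<Rightarrow> G (full_blocks n w))
        = (case p of (w, i, j) \<Rightarrow> G ((full_blocks n w)[i := l, j := l]))"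
      using u(2) V p(1) by simp
  next
    fix p assume "p \<in> Sigma ?W ?D"
    then obtain w i j where p: "p = (w, i, j)" "w \<in> ?W" "i \<in> ?B l w" "j \<in> ?B l w" "i \<noteq> j"
      by auto
    have ij: "i < length (full_blocks n w)" "j < length (full_blocks n w)" "w ! i = l" "w ! j = l"
      using p(3,4) by (auto simp: B)
    have eq: "(l - 1) + (l + 1) = w ! i + w ! j" using ij(3,4) l by simp
    note u = upd[OF p(2) ij(1,2) p(5) eq]
    show "(case case p of (w, i, j) \<Rightarrow> (w[i := l - 1, j := l + 1], i, j) of
        (w, i, j) \<Rightarrow> (w[i := l, j := l], i, j)) = p"
      using p(1) list_update2_cancel[OF p(5) ij(3)[symmetric] ij(4)[symmetric]] by simp
    show "(case p of (w, i, j) \<Rightarrow> (w[i := l - 1, j := l + 1], i, j))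
        \<in> Sigma ?W (\<lambda>w. ?B (l - 1) w \<times> ?B (l + 1) w)"
      using u V ij(1,2) fb(2)[OF ij(1)] fb(2)[OF ij(2)] p(1,5)
      by (auto simp: blocks_of_length_def nth_list_update)
  qed
  also have "\<dots> = (\<Sum>w\<in>?W. \<Sum>p\<in>?D w. G (full_blocks n w))"
    using fin by (subst sum.Sigma) (auto simp: case_prod_unfold)
  also have "\<dots> = (\<Sum>w\<in>?W. real (card (?B l w)) * (real (card (?B l w)) - 1) * G (full_blocks n w))"
  proof (rule sum.cong[OF refl])
    fix w
    have "card (?D w) = card (?B l w) * card (?B l w) - card (?B l w)"
      by (subst card_Diff_subset) (auto simp: card_image inj_on_def card_cartesian_product)
    then have "real (card (?D w)) = real (card (?B l w)) * (real (card (?B l w)) - 1)"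
      by (cases "card (?B l w)") (auto simp: algebra_simps)
    then show "(\<Sum>p\<in>?D w. G (full_blocks n w))
        = real (card (?B l w)) * (real (card (?B l w)) - 1) * G (full_blocks n w)" by simp
  qed
  finally show ?thesis .
qed

text \<open>The product \<open>a c\<close>, set to 0 on words too short to exhibit the overshooting
  block. This convention makes the identities between weights exact for every word length.\<close>

definition block_weight :: "nat \<Rightarrow> nat \<Rightarrow> nat list \<Rightarrow> real" where
  "block_weight l n w = (if n < sum_list w
     then real (card (blocks_of_length (l - 1) (full_blocks n w)))
        * real (card (blocks_of_length (l + 1) (full_blocks n w)))
     else 0)"

text \<open>The excess \<open>m (m - 1) - a c\<close>. Adding \<open>block_weight\<close> gives the
  factor produced by \<open>sum_modified_blocks\<close>.\<close>

definition block_score :: "nat \<Rightarrow> nat \<Rightarrow> nat list \<Rightarrow> real" where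
  "block_score l n w = (if n < sum_list w
     then real (card (blocks_of_length l (full_blocks n w)))
          * (real (card (blocks_of_length l (full_blocks n w))) - 1)
        - real (card (blocks_of_length (l - 1) (full_blocks n w)))
          * real (card (blocks_of_length (l + 1) (full_blocks n w)))
     else 0)"

text \<open>Chebyshev: the mean total \<open>2 n l\<close> is at least \<open>2 n\<close>, so a
  total of at most \<open>n\<close> is a deviation of at least \<open>n\<close>, while the second
  moment of the centred sum is at most \<open>2 n\<close>.\<close>

lemma word_avg_short:
  assumes l: "l > 0" and V: "V = {l - 1, l, l + 1}" and n: "n > 0"
  shows "word_avg V (2 * n) (\<lambda>w. if sum_list w \<le> n then 1 else 0) \<le> 2 / real n"
proof -
  let ?f = "\<lambda>x. real x - real l"
  have V': "finite V" "V \<noteq> {}" "(\<Sum>x\<in>V. ?f x) = 0" "\<And>x. x \<in> V \<Longrightarrow> \<bar>?f x\<bar> \<le> 1"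
    unfolding V sum_three_lengths[OF l] using l by (auto simp: of_nat_diff)
  have "word_avg V (2 * n) (\<lambda>w. if sum_list w \<le> n then 1 else 0)
      \<le> word_avg V (2 * n) (\<lambda>w. (1 / (real n)\<^sup>2) * (stopped_sum ?f n w)\<^sup>2)"
  proof (rule word_avg_mono)
    fix w assume w: "w \<in> words V (2 * n)"
    show "(if sum_list w \<le> n then 1 else 0) \<le> (1 / (real n)\<^sup>2) * (stopped_sum ?f n w)\<^sup>2"
    proof (cases "sum_list w \<le> n")
      case True
      have "full_blocks n w = w" using full_blocks_append[of w n "[]"] True by simp
      then have "stopped_sum ?f n w = sum_list (map ?f w)" using True by (simp add: stopped_sum_eq)
      also have "\<dots> = real (sum_list w) - real l * real (2 * n)"
        using w by (simp add: words_def sum_list_map_diff_const)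
      finally have s: "stopped_sum ?f n w = real (sum_list w) - real l * real (2 * n)" .
      have "1 * (2 * real n) \<le> real l * real (2 * n)" using l by (intro mult_mono) auto
      then have "real n \<le> \<bar>stopped_sum ?f n w\<bar>" using s True by simp
      then have "(real n)\<^sup>2 \<le> (stopped_sum ?f n w)\<^sup>2"
        using power_mono[of "real n" "\<bar>stopped_sum ?f n w\<bar>" 2] by simp
      then show ?thesis using True n by (simp add: field_simps)
    qed simp
  qed
  also have "\<dots> \<le> (1 / (real n)\<^sup>2) * (real (2 * n) * 1\<^sup>2)"
    unfolding word_avg_cmult using V' by (intro mult_left_mono word_avg_stopped_sum_square) auto
  also have "\<dots> = 2 / real n" using n by (simp add: power2_eq_square field_simps)
  finally show ?thesis .
qed

text \<open>The difference of the sides is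
  \<open>(a - b)\<^sup>2 + (a - 3)\<^sup>2 + (b - 3)\<^sup>2\<close>.\<close>

lemma add_three_square_le: "(a + b + 3)\<^sup>2 \<le> 3 * (a\<^sup>2 + b\<^sup>2 + 9)" for a b :: real
  using sum_squares_ge_zero[of "a - b" "a - 3"] zero_le_power2[of "b - 3"]
  by (simp add: power2_eq_square algebra_simps)

lemma word_avg_block_score_square:
  assumes l: "l > 0" and V: "V = {l - 1, l, l + 1}" and n: "n > 0"
  shows "word_avg V (2 * n) (\<lambda>w. (block_score l n w)\<^sup>2) \<le> 156 * real n ^ 3"
proof -
  \<comment> \<open>Comparing two of the equally likely lengths gives a centred function, whose sum
    over the full blocks is the difference of the two counts.\<close>
  define f where "f p x = (if x = l then 1 else 0) - (if x = p then 1 else (0::real))" for p x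
  have V': "finite V" "V \<noteq> {}" using V by auto
  have f: "(\<Sum>x\<in>V. f p x) = 0" "\<And>x. \<bar>f p x\<bar> \<le> 1" if "p \<in> V" for p
    using that l unfolding V sum_three_lengths[OF l] by (auto simp: f_def)
  have pV: "l - 1 \<in> V" "l + 1 \<in> V" using V by auto
  let ?Z = "\<lambda>p. stopped_sum (f p) n"
  have "word_avg V (2 * n) (\<lambda>w. (block_score l n w)\<^sup>2)
    \<le> word_avg V (2 * n) (\<lambda>w. (12 * (real n)\<^sup>2) * ((?Z (l - 1) w)\<^sup>2 + (?Z (l + 1) w)\<^sup>2 + 9))"
  proof (rule word_avg_mono)
    fix w assume w: "w \<in> words V (2 * n)"
    show "(block_score l n w)\<^sup>2 \<le> (12 * (real n)\<^sup>2) * ((?Z (l - 1) w)\<^sup>2 + (?Z (l + 1) w)\<^sup>2 + 9)"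
    proof (cases "n < sum_list w")
      case True
      let ?N = "\<lambda>p. real (card (blocks_of_length p (full_blocks n w)))"
      have N: "0 \<le> ?N p" "?N p \<le> 2 * real n" for p
        using card_blocks_of_length_le[of p "full_blocks n w"] length_full_blocks_le[of n w] w
        by (auto simp: words_def)
      have d: "\<bar>?N l - ?N p\<bar> \<le> \<bar>?Z p w\<bar> + 1" if "p \<in> V" for p
      proof -
        have "?N l - ?N p = sum_list (map (f p) (full_blocks n w))"
          unfolding card_blocks_of_length f_def by (simp add: sum_list_subtractf)
        then show ?thesis using sum_list_full_blocks_approx[OF True, of "f p" 1] f(2)[OF that] by simp
      qed
      let ?D = "\<bar>?Z (l - 1) w\<bar> + \<bar>?Z (l + 1) w\<bar> + 3"
      \<comment> \<open>This is \<open>m (m - a) + a (m - c) - m\<close>: each quadratic term is a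
        count, at most \<open>2 n\<close>, times a difference of counts, of order
        \<open>sqrt n\<close>. The 3 in \<open>?D\<close> collects the overshooting block, once for
        each difference, and the term \<open>- m\<close>.\<close>
      have "block_score l n w = ?N l * (?N l - ?N (l - 1)) + ?N (l - 1) * (?N l - ?N (l + 1)) - ?N l"
        using True by (simp add: block_score_def algebra_simps)
      also have "\<bar>\<dots>\<bar> \<le> \<bar>?N l * (?N l - ?N (l - 1))\<bar> + \<bar>?N (l - 1) * (?N l - ?N (l + 1))\<bar> + \<bar>?N l\<bar>"
        by linarith
      also have "\<dots> \<le> 2 * real n * (\<bar>?Z (l - 1) w\<bar> + 1) + 2 * real n * (\<bar>?Z (l + 1) w\<bar> + 1) + 2 * real n"
        unfolding abs_mult using N d[OF pV(1)] d[OF pV(2)]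
        by (intro add_mono mult_mono) auto
      also have "\<dots> = 2 * real n * ?D" by (simp add: algebra_simps)
      finally have "\<bar>block_score l n w\<bar> \<le> 2 * real n * ?D" .
      then have "(block_score l n w)\<^sup>2 \<le> (2 * real n * ?D)\<^sup>2"
        using power_mono[of "\<bar>block_score l n w\<bar>" _ 2] by simp
      also have "\<dots> = 4 * (real n)\<^sup>2 * ?D\<^sup>2" by (simp add: power_mult_distrib)
      also have "\<dots> \<le> 4 * (real n)\<^sup>2 * (3 * ((?Z (l - 1) w)\<^sup>2 + (?Z (l + 1) w)\<^sup>2 + 9))"
      proof (rule mult_left_mono)
        show "?D\<^sup>2 \<le> 3 * ((?Z (l - 1) w)\<^sup>2 + (?Z (l + 1) w)\<^sup>2 + 9)"
          using add_three_square_le[of "\<bar>?Z (l - 1) w\<bar>" "\<bar>?Z (l + 1) w\<bar>"] by simp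
      qed simp
      finally show ?thesis by (simp add: algebra_simps)
    qed (simp add: block_score_def)
  qed
  also have "\<dots> = (12 * (real n)\<^sup>2) * (word_avg V (2 * n) (\<lambda>w. (?Z (l - 1) w)\<^sup>2)
      + word_avg V (2 * n) (\<lambda>w. (?Z (l + 1) w)\<^sup>2) + 9)"
    by (simp add: word_avg_cmult word_avg_add word_avg_const[OF V'])
  \<comment> \<open>The factor 156 arises as \<open>12 * (2 + 2 + 9)\<close>.\<close>
  also have "\<dots> \<le> (12 * (real n)\<^sup>2) * (real (2 * n) * 1\<^sup>2 + real (2 * n) * 1\<^sup>2 + 9 * real n)"
    using n by (intro mult_left_mono add_mono word_avg_stopped_sum_square[OF V'] f pV) auto
  also have "\<dots> = 156 * real n ^ 3" by (simp add: power2_eq_square power3_eq_cube)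
  finally show ?thesis .
qed

text \<open>With \<open>T\<close> full blocks, \<open>l T\<close> is close to \<open>n\<close> and
  each count is close to \<open>T / 3\<close>, both up to stopped sums of order
  \<open>sqrt n\<close>. The product of two counts then deviates by order \<open>n * sqrt n\<close>;
  words that are too short contribute at most \<open>n\<^sup>2\<close> times
  \<open>2 / n\<close>.\<close>

lemma word_avg_block_weight:
  assumes l: "l > 0" and V: "V = {l - 1, l, l + 1}" and n: "n > 0"
  shows "word_avg V (2 * n) (\<lambda>w. \<bar>block_weight l n w - (real n / (3 * real l))\<^sup>2\<bar>)
    \<le> 100 * (real n * sqrt (real n))"
proof -
  define f where "f p x = (if x = p then 1 else 0) - (1 / 3::real)" for p x :: nat
  define g where "g x = real x - real l" for x
  have V': "finite V" "V \<noteq> {}" using V by auto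
  have f: "(\<Sum>x\<in>V. f p x) = 0" "\<And>x. \<bar>f p x\<bar> \<le> 1" if "p \<in> V" for p
    using that l unfolding V sum_three_lengths[OF l] by (auto simp: f_def)
  have g: "(\<Sum>x\<in>V. g x) = 0" "\<And>x. x \<in> V \<Longrightarrow> \<bar>g x\<bar> \<le> 1"
    unfolding V sum_three_lengths[OF l] using l by (auto simp: g_def of_nat_diff)
  have pV: "l - 1 \<in> V" "l + 1 \<in> V" using V by auto
  let ?A = "word_avg V (2 * n)"
  let ?\<mu> = "real n / (3 * real l)"
  \<comment> \<open>Common bound for the deviation of a count from \<open>?\<mu>\<close>. Of the 3,
    one comes from the overshooting block in the sum of \<open>f p\<close>; the other two cover that
    block in the sum of \<open>g\<close> and the cut rest.\<close>
  define U where "U p w = \<bar>stopped_sum (f p) n w\<bar> + \<bar>stopped_sum g n w\<bar> + 3" for p w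
  have U0: "0 \<le> U p w" for p w by (simp add: U_def)
  have \<mu>: "0 \<le> ?\<mu>" "?\<mu> \<le> real n"
  proof -
    have "real n * 1 \<le> real n * (3 * real l)" using l by (intro mult_left_mono) auto
    then show "?\<mu> \<le> real n" using l by (simp add: field_simps)
  qed (use l in simp)
  have U2: "?A (\<lambda>w. (U p w)\<^sup>2) \<le> 39 * real n" if "p \<in> V" for p
  proof -
    have "?A (\<lambda>w. (U p w)\<^sup>2) \<le> ?A (\<lambda>w. 3 * ((stopped_sum (f p) n w)\<^sup>2 + (stopped_sum g n w)\<^sup>2 + 9))"
    proof (rule word_avg_mono)
      fix w
      show "(U p w)\<^sup>2 \<le> 3 * ((stopped_sum (f p) n w)\<^sup>2 + (stopped_sum g n w)\<^sup>2 + 9)"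
        using add_three_square_le[of "\<bar>stopped_sum (f p) n w\<bar>" "\<bar>stopped_sum g n w\<bar>"]
        by (simp add: U_def)
    qed
    also have "\<dots> = 3 * (?A (\<lambda>w. (stopped_sum (f p) n w)\<^sup>2) + ?A (\<lambda>w. (stopped_sum g n w)\<^sup>2) + 9)"
      by (simp add: word_avg_cmult word_avg_add word_avg_const[OF V'])
    also have "\<dots> \<le> 3 * (real (2 * n) * 1\<^sup>2 + real (2 * n) * 1\<^sup>2 + 9 * real n)"
      using n by (intro mult_left_mono add_mono word_avg_stopped_sum_square[OF V'] f g that) auto
    finally show ?thesis by simp
  qed
  have U1: "?A (U p) \<le> 20 * sqrt (real n)" if "p \<in> V" for p
  proof -
    \<comment> \<open>AM-GM with weight \<open>sqrt n\<close> turns the second moment into a first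
      moment; the constant is \<open>1 / 2 + 39 / 2 = 20\<close>.\<close>
    have "?A (U p) \<le> ?A (\<lambda>w. sqrt (real n) / 2 + (1 / (2 * sqrt (real n))) * (U p w)\<^sup>2)"
    proof (rule word_avg_mono)
      fix w
      have "0 \<le> (U p w - sqrt (real n))\<^sup>2" by simp
      then have "2 * (U p w * sqrt (real n)) \<le> (U p w)\<^sup>2 + real n" by (simp add: power2_diff)
      then show "U p w \<le> sqrt (real n) / 2 + (1 / (2 * sqrt (real n))) * (U p w)\<^sup>2"
        using n by (simp add: field_simps)
    qed
    also have "\<dots> = sqrt (real n) / 2 + (1 / (2 * sqrt (real n))) * ?A (\<lambda>w. (U p w)\<^sup>2)"
      by (simp only: word_avg_cmult word_avg_add word_avg_const[OF V'])
    also have "\<dots> \<le> sqrt (real n) / 2 + (1 / (2 * sqrt (real n))) * (39 * real n)"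
      using U2[OF that] by (intro add_left_mono mult_left_mono) auto
    also have "\<dots> = 20 * sqrt (real n)" using n by (simp add: field_simps)
    finally show ?thesis .
  qed
  have "?A (\<lambda>w. \<bar>block_weight l n w - ?\<mu>\<^sup>2\<bar>) \<le>
    ?A (\<lambda>w. (real n)\<^sup>2 * (if sum_list w \<le> n then 1 else 0)
      + 1 / 2 * ((U (l - 1) w)\<^sup>2 + (U (l + 1) w)\<^sup>2) + real n * (U (l - 1) w + U (l + 1) w))"
  proof (rule word_avg_mono)
    fix w assume w: "w \<in> words V (2 * n)"
    show "\<bar>block_weight l n w - ?\<mu>\<^sup>2\<bar> \<le> (real n)\<^sup>2 * (if sum_list w \<le> n then 1 else 0)
      + 1 / 2 * ((U (l - 1) w)\<^sup>2 + (U (l + 1) w)\<^sup>2) + real n * (U (l - 1) w + U (l + 1) w)"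
    proof (cases "n < sum_list w")
      case False
      have "?\<mu>\<^sup>2 \<le> (real n)\<^sup>2" using \<mu> by (intro power_mono)
      also have "\<dots> \<le> (real n)\<^sup>2 + 1 / 2 * ((U (l - 1) w)\<^sup>2 + (U (l + 1) w)\<^sup>2)
          + real n * (U (l - 1) w + U (l + 1) w)"
        using U0 by (simp add: add_nonneg_nonneg)
      finally have *: "?\<mu>\<^sup>2 \<le> (real n)\<^sup>2 + 1 / 2 * ((U (l - 1) w)\<^sup>2 + (U (l + 1) w)\<^sup>2)
          + real n * (U (l - 1) w + U (l + 1) w)" .
      have "block_weight l n w = 0" "(if sum_list w \<le> n then 1 else 0 :: real) = 1"
        using False by (simp_all add: block_weight_def)
      then show ?thesis
        using * by (simp only: diff_0 abs_minus_cancel abs_power2 mult_1_right)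
    next
      case True
      let ?N = "\<lambda>p. real (card (blocks_of_length p (full_blocks n w)))"
      let ?T = "real (length (full_blocks n w))"
      have wV: "set w \<subseteq> V" using w by (simp add: words_def)
      obtain x r where r: "w = full_blocks n w @ x # r" "n < sum_list (full_blocks n w) + x"
        by (rule full_blocks_decomp_Cons[OF True])
      have "x \<in> set w" by (subst r(1)) simp
      then have x: "x \<le> l + 1" using wV V by auto
      have "sum_list (map g (full_blocks n w)) = real (sum_list (full_blocks n w)) - real l * ?T"
        unfolding g_def by (rule sum_list_map_diff_const)
      moreover have "\<bar>sum_list (map g (full_blocks n w))\<bar> \<le> \<bar>stopped_sum g n w\<bar> + 1"
        using g(2) wV by (intro sum_list_full_blocks_approx[OF True]) auto
      \<comment> \<open>The rest is shorter than the overshooting block, hence at most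
        \<open>l\<close> long.\<close>
      ultimately have T: "\<bar>real l * ?T - real n\<bar> \<le> \<bar>stopped_sum g n w\<bar> + 1 + real l"
        using r(2) x sum_full_blocks_le[of n w] by linarith
      have N: "\<bar>?N p - ?\<mu>\<bar> \<le> U p w" if "p \<in> V" for p
      proof -
        have "?N p - ?T / 3 = sum_list (map (f p) (full_blocks n w))"
          unfolding card_blocks_of_length f_def by (simp add: sum_list_subtractf sum_list_triv)
        then have 1: "\<bar>?N p - ?T / 3\<bar> \<le> \<bar>stopped_sum (f p) n w\<bar> + 1"
          using sum_list_full_blocks_approx[OF True, of "f p" 1] f(2)[OF that] by simp
        have "3 * real l * \<bar>?T / 3 - ?\<mu>\<bar> = \<bar>real l * ?T - real n\<bar>"
          using l by (subst abs_of_nonneg[of "3 * real l", symmetric], simp)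
            (simp add: abs_mult[symmetric] field_simps)
        also have "\<dots> \<le> 3 * real l * (\<bar>stopped_sum g n w\<bar> + 2)"
        proof -
          have "1 * \<bar>stopped_sum g n w\<bar> \<le> real l * \<bar>stopped_sum g n w\<bar>"
            using l by (intro mult_right_mono) auto
          then show ?thesis using T l by (simp add: algebra_simps)
        qed
        finally have "\<bar>?T / 3 - ?\<mu>\<bar> \<le> \<bar>stopped_sum g n w\<bar> + 2" using l by simp
        then show ?thesis using 1 unfolding U_def by linarith
      qed
      let ?u = "?N (l - 1) - ?\<mu>" and ?v = "?N (l + 1) - ?\<mu>"
      \<comment> \<open>Expansion around \<open>?\<mu>\<close>: the linear part has order
        \<open>n * sqrt n\<close>, the product of the deviations only order
        \<open>n\<close>.\<close>
      have "block_weight l n w - ?\<mu>\<^sup>2 = ?u * ?v + ?\<mu> * (?u + ?v)"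
        using True by (simp add: block_weight_def power2_eq_square algebra_simps)
      also have "\<bar>\<dots>\<bar> \<le> \<bar>?u\<bar> * \<bar>?v\<bar> + ?\<mu> * (\<bar>?u\<bar> + \<bar>?v\<bar>)"
      proof -
        have "\<bar>?\<mu> * (?u + ?v)\<bar> \<le> ?\<mu> * (\<bar>?u\<bar> + \<bar>?v\<bar>)"
          unfolding abs_mult abs_of_nonneg[OF \<mu>(1)]
          by (intro mult_left_mono abs_triangle_ineq \<mu>(1))
        moreover have "\<bar>?u * ?v\<bar> = \<bar>?u\<bar> * \<bar>?v\<bar>" by (rule abs_mult)
        ultimately show ?thesis using abs_triangle_ineq[of "?u * ?v" "?\<mu> * (?u + ?v)"] by linarith
      qed
      also have "\<dots> \<le> U (l - 1) w * U (l + 1) w + real n * (U (l - 1) w + U (l + 1) w)"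
        using N[OF pV(1)] N[OF pV(2)] \<mu> U0 by (intro add_mono mult_mono) auto
      also have "U (l - 1) w * U (l + 1) w \<le> 1 / 2 * ((U (l - 1) w)\<^sup>2 + (U (l + 1) w)\<^sup>2)"
        using sum_squares_bound[of "U (l - 1) w" "U (l + 1) w"] by simp
      finally show ?thesis using True by simp
    qed
  qed
  also have "\<dots> = (real n)\<^sup>2 * ?A (\<lambda>w. if sum_list w \<le> n then 1 else 0)
      + 1 / 2 * (?A (\<lambda>w. (U (l - 1) w)\<^sup>2) + ?A (\<lambda>w. (U (l + 1) w)\<^sup>2))
      + real n * (?A (U (l - 1)) + ?A (U (l + 1)))"
    by (simp only: word_avg_add word_avg_cmult)
  also have "\<dots> \<le> (real n)\<^sup>2 * (2 / real n) + 1 / 2 * (39 * real n + 39 * real n)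
      + real n * (20 * sqrt (real n) + 20 * sqrt (real n))"
    by (intro add_mono mult_left_mono U1 U2 pV word_avg_short[OF l V n]) auto
  also have "\<dots> = 41 * (real n * 1) + 40 * (real n * sqrt (real n))"
    using n by (simp add: power2_eq_square)
  also have "\<dots> \<le> 41 * (real n * sqrt (real n)) + 40 * (real n * sqrt (real n))"
    using n by (intro add_right_mono mult_left_mono) auto
  also have "\<dots> \<le> 100 * (real n * sqrt (real n))" by simp
  finally show ?thesis .
qed

section \<open>The law of the model\<close>

text \<open>Fixing one of the countably many values of \<open>f\<close> leaves a function of
  \<open>g\<close> alone, and every function on a discrete space is measurable; hence
  \<open>F\<close> is arbitrary.\<close>

lemma measurable_count_space_comp2:
  fixes f :: "'a \<Rightarrow> 'b::countable"
  assumes "f \<in> measurable N (count_space UNIV)" "g \<in> measurable N (count_space UNIV)"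
  shows "(\<lambda>\<omega>. F (f \<omega>) (g \<omega>)) \<in> measurable N (count_space UNIV)"
  by (rule measurable_compose_countable[OF _ assms(1)])
    (rule measurable_compose[OF assms(2)], simp)

lemma measurable_map_upt:
  fixes f :: "nat \<Rightarrow> 'a \<Rightarrow> 'b::countable"
  assumes "\<And>k. f k \<in> measurable N (count_space UNIV)"
  shows "(\<lambda>\<omega>. map (\<lambda>k. f k \<omega>) [0..<K]) \<in> measurable N (count_space UNIV)"
proof (induction K)
  case (Suc K)
  show ?case
    using measurable_count_space_comp2[OF Suc assms[of K], of "\<lambda>xs x. xs @ [x]"] by simp
qed simp

lemma pred_less_sum:
  fixes b :: "nat \<Rightarrow> 'a \<Rightarrow> nat"
  assumes "\<And>k. b k \<in> measurable N (count_space UNIV)"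
  shows "Measurable.pred N (\<lambda>\<omega>. n < (\<Sum>j<k. b j \<omega>))"
proof -
  have "(\<lambda>\<omega>. n < sum_list (map (\<lambda>j. b j \<omega>) [0..<k])) \<in> measurable N (count_space UNIV)"
    by (rule measurable_compose[OF measurable_map_upt[OF assms]]) simp
  then show ?thesis by (simp add: interv_sum_list_conv_sum_set_nat lessThan_atLeast0)
qed

lemma measurable_block_string:
  fixes b :: "nat \<Rightarrow> 'a \<Rightarrow> nat"
  assumes s: "s \<in> measurable N (count_space UNIV)"
    and b: "\<And>k. b k \<in> measurable N (count_space UNIV)"
  shows "(\<lambda>\<omega>. block_string (s \<omega>) (\<lambda>k. b k \<omega>) n) \<in> measurable N (count_space UNIV)"
  unfolding block_string_def
proof (rule measurable_map_upt)
  fix i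
  have "(\<lambda>\<omega>. LEAST k. i < (\<Sum>j\<le>k. b j \<omega>)) \<in> measurable N (count_space UNIV)"
    unfolding lessThan_Suc_atMost[symmetric] by (intro measurable_Least pred_less_sum b)
  from measurable_count_space_comp2[OF s this, of "\<lambda>s k. (s + k) mod 2"]
  show "(\<lambda>\<omega>. block_seq (s \<omega>) (\<lambda>k. b k \<omega>) i) \<in> measurable N (count_space UNIV)"
    by (simp add: block_seq_def)
qed

text \<open>If the block lengths have a finite sum at most \<open>n\<close>, then the value of \<open>num_blocks\<close> is the
  unspecified maximum of an infinite set.\<close>

lemma num_blocks_eq:
  "num_blocks b n = (if \<exists>k. n < (\<Sum>j<Suc k. b j) then LEAST k. n < (\<Sum>j<Suc k. b j) else Max UNIV)"
proof (cases "\<exists>k. n < (\<Sum>j<Suc k. b j)")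
  case True
  let ?t = "LEAST k. n < (\<Sum>j<Suc k. b j)"
  have t: "n < (\<Sum>j<Suc ?t. b j)" using True by (rule LeastI_ex)
  have "{k. (\<Sum>j<k. b j) \<le> n} = {..?t}"
  proof (intro set_eqI iffI)
    fix k assume "k \<in> {k. (\<Sum>j<k. b j) \<le> n}"
    then have k: "(\<Sum>j<k. b j) \<le> n" by simp
    have "k \<le> ?t"
    proof (rule ccontr)
      assume "\<not> k \<le> ?t"
      then have "(\<Sum>j<Suc ?t. b j) \<le> (\<Sum>j<k. b j)" by (intro sum_mono2) auto
      then show False using k t by linarith
    qed
    then show "k \<in> {..?t}" by simp
  next
    fix k assume k: "k \<in> {..?t}"
    have "(\<Sum>j<k. b j) \<le> n"
    proof (cases k)
      case (Suc m)
      then have "m < ?t" using k by simp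
      from not_less_Least[OF this] show ?thesis unfolding Suc by (rule leI)
    qed simp
    then show "k \<in> {k. (\<Sum>j<k. b j) \<le> n}" by simp
  qed
  then have "num_blocks b n = ?t" unfolding num_blocks_def by (auto intro: Max_eqI)
  then show ?thesis unfolding if_P[OF True] .
next
  case False
  then have Suc: "(\<Sum>j<Suc k. b j) \<le> n" for k by (simp only: not_ex not_less)
  have "(\<Sum>j<k. b j) \<le> n" for k using Suc by (cases k) (simp, simp only:)
  then have "{k. (\<Sum>j<k. b j) \<le> n} = UNIV" by auto
  then show ?thesis unfolding if_not_P[OF False] num_blocks_def by simp
qed

lemma measurable_blocks:
  fixes b :: "nat \<Rightarrow> 'a \<Rightarrow> nat"
  assumes b: "\<And>k. b k \<in> measurable N (count_space UNIV)"
  shows "(\<lambda>\<omega>. blocks (\<lambda>k. b k \<omega>) n) \<in> measurable N (count_space UNIV)"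
proof -
  have p: "Measurable.pred N (\<lambda>\<omega>. n < (\<Sum>j<Suc k. b j \<omega>))" for k
    by (rule pred_less_sum[OF b])
  have "(\<lambda>\<omega>. num_blocks (\<lambda>k. b k \<omega>) n) \<in> measurable N (count_space UNIV)"
    unfolding num_blocks_eq using p
    by (intro measurable_If measurable_Least pred_intros_countable) simp_all
  then show ?thesis
    unfolding blocks_def by (intro measurable_compose_countable[OF measurable_map_upt[OF b]])
qed

lemma (in prob_space) expectation_finite_values:
  fixes \<phi> :: "'b \<Rightarrow> real"
  assumes U: "U \<in> measurable M (count_space UNIV)" and S: "finite S" "AE \<omega> in M. U \<omega> \<in> S"
    and m: "(\<lambda>\<omega>. \<phi> (U \<omega>)) \<in> borel_measurable M"
  shows "expectation (\<lambda>\<omega>. \<phi> (U \<omega>)) = (\<Sum>u\<in>S. \<phi> u * prob {\<omega> \<in> space M. U \<omega> = u})"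
proof -
  have ev: "{\<omega> \<in> space M. U \<omega> = u} \<in> events" for u
    using measurable_sets[OF U, of "{u}"] by (simp add: vimage_def Int_def conj_commute)
  have "expectation (\<lambda>\<omega>. \<phi> (U \<omega>))
      = expectation (\<lambda>\<omega>. \<Sum>u\<in>S. \<phi> u * indicator {\<omega> \<in> space M. U \<omega> = u} \<omega>)"
  proof (rule integral_cong_AE)
    show "AE \<omega> in M. \<phi> (U \<omega>) = (\<Sum>u\<in>S. \<phi> u * indicator {\<omega> \<in> space M. U \<omega> = u} \<omega>)"
      using S(2) AE_space
    proof eventually_elim
      case (elim \<omega>)
      then have "(\<Sum>u\<in>S. \<phi> u * indicator {\<omega> \<in> space M. U \<omega> = u} \<omega>)
          = (\<Sum>u\<in>S. if u = U \<omega> then \<phi> u else 0)"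
        by (intro sum.cong) (auto simp: indicator_def)
      then show ?case using elim S(1) by simp
    qed
  qed (use m ev in auto)
  also have "\<dots> = (\<Sum>u\<in>S. \<phi> u * prob {\<omega> \<in> space M. U \<omega> = u})"
    by (subst Bochner_Integration.integral_sum) (use ev in \<open>auto simp: emeasure_eq_measure\<close>)
  finally show ?thesis .
qed

context block_model
begin

abbreviation V :: "nat set" where "V \<equiv> {l - 1, l, l + 1}"

definition source_var :: "source \<Rightarrow> 'a \<Rightarrow> nat" where
  "source_var v = (case v of SymX \<Rightarrow> sX | SymY \<Rightarrow> sY | LenX k \<Rightarrow> BX k | LenY k \<Rightarrow> BY k)"

definition word_X :: "nat \<Rightarrow> 'a \<Rightarrow> nat list" where
  "word_X K \<omega> = map (\<lambda>k. BX k \<omega>) [0..<K]"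

definition word_Y :: "nat \<Rightarrow> 'a \<Rightarrow> nat list" where
  "word_Y K \<omega> = map (\<lambda>k. BY k \<omega>) [0..<K]"

lemma card_V: "card V = 3"
proof -
  obtain k where "l = Suc k" using l_pos by (cases l) auto
  then show ?thesis by simp
qed

lemma measurable_source_var: "source_var v \<in> measurable M (count_space UNIV)"
  using indep_sources unfolding indep_vars_def source_var_def by auto

lemma source_var_simps [simp]:
  "source_var SymX = sX" "source_var SymY = sY" "source_var (LenX k) = BX k" "source_var (LenY k) = BY k"
  by (simp_all add: source_var_def)

lemma measurable_sources [measurable]:
  "sX \<in> measurable M (count_space UNIV)" "sY \<in> measurable M (count_space UNIV)"
  "BX k \<in> measurable M (count_space UNIV)" "BY k \<in> measurable M (count_space UNIV)"
  using measurable_source_var[of SymX] measurable_source_var[of SymY]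
    measurable_source_var[of "LenX k"] measurable_source_var[of "LenY k"] by simp_all

lemma measurable_word [measurable]:
  "word_X K \<in> measurable M (count_space UNIV)" "word_Y K \<in> measurable M (count_space UNIV)"
  using measurable_map_upt[of BX M K] measurable_map_upt[of BY M K] measurable_sources
  by (simp_all add: word_X_def[abs_def] word_Y_def[abs_def])

lemma measurable_X [measurable]: "X n \<in> measurable M (count_space UNIV)"
  using measurable_block_string[of sX M BX n] measurable_sources
  by (simp add: X_eq[abs_def])

lemma measurable_Y [measurable]: "Y n \<in> measurable M (count_space UNIV)"
  using measurable_block_string[of sY M BY n] measurable_sources
  by (simp add: Y_eq[abs_def])

lemma measurable_blocks_X [measurable]:
  "(\<lambda>\<omega>. blocks (\<lambda>k. BX k \<omega>) n) \<in> measurable M (count_space UNIV)"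
  by (rule measurable_blocks) measurable

lemma measurable_X' [measurable]: "X' n \<in> measurable M (count_space UNIV)"
proof -
  let ?no_pair = "\<lambda>bs. blocks_of_length (l - 1) bs = {} \<or> blocks_of_length (l + 1) bs = {}"
  have "(\<lambda>\<omega>. modify_blocks l n (\<lambda>k. BX k \<omega>) (I n \<omega>) (J n \<omega>) k) \<in> measurable M (count_space UNIV)" for k
  proof -
    have 1: "(\<lambda>\<omega>. ?no_pair (blocks (\<lambda>k. BX k \<omega>) n)) \<in> measurable M (count_space UNIV)"
      by (rule measurable_compose[OF measurable_blocks_X]) simp
    have 2: "(\<lambda>\<omega>. k = I n \<omega> \<or> k = J n \<omega>) \<in> measurable M (count_space UNIV)"
      by (rule measurable_count_space_comp2[OF measurable_I measurable_J])
    have "(\<lambda>\<omega>. if ?no_pair (blocks (\<lambda>k. BX k \<omega>) n) then BX k \<omega>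
        else if k = I n \<omega> \<or> k = J n \<omega> then l else BX k \<omega>) \<in> measurable M (count_space UNIV)"
      using 1 2 by (intro measurable_If) (auto simp: pred_def)
    moreover have "modify_blocks l n b i j k
        = (if ?no_pair (blocks b n) then b k else if k = i \<or> k = j then l else b k)" for b i j
      by (simp add: modify_blocks_def)
    ultimately show ?thesis by simp
  qed
  from measurable_block_string[of sX M, OF measurable_sources(1) this] show ?thesis
    by (simp add: X'_eq[abs_def])
qed

lemma prob_source_var:
  "prob (sX -` {s} \<inter> space M) = pmf (pmf_of_set {0, 1}) s"
  "prob (sY -` {s} \<inter> space M) = pmf (pmf_of_set {0, 1}) s"
  "prob (BX k -` {x} \<inter> space M) = pmf (pmf_of_set V) x"
  "prob (BY k -` {x} \<inter> space M) = pmf (pmf_of_set V) x"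
  using measure_distr[of sX M "count_space UNIV" "{s}"] measure_distr[of sY M "count_space UNIV" "{s}"]
    measure_distr[of "BX k" M "count_space UNIV" "{x}"] measure_distr[of "BY k" M "count_space UNIV" "{x}"]
  by (simp_all add: law_sX law_sY law_BX law_BY measure_pmf_single)

lemma AE_sources:
  "AE \<omega> in M. sX \<omega> \<in> {0, 1}" "AE \<omega> in M. sY \<omega> \<in> {0, 1}"
  "AE \<omega> in M. \<forall>k. BX k \<omega> \<in> V" "AE \<omega> in M. \<forall>k. BY k \<omega> \<in> V"
proof -
  have *: "AE \<omega> in M. f \<omega> \<in> A"
    if "f \<in> measurable M (count_space UNIV)" "distr M (count_space UNIV) f = measure_pmf (pmf_of_set A)"
      "finite A" "A \<noteq> {}" for f :: "'a \<Rightarrow> nat" and A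
  proof -
    have "AE x in distr M (count_space UNIV) f. x \<in> A"
      unfolding that(2) using AE_measure_pmf[of "pmf_of_set A"] that(3,4) by simp
    then show ?thesis using that(1) by (simp add: AE_distr_iff)
  qed
  show "AE \<omega> in M. sX \<omega> \<in> {0, 1}" by (rule *[OF measurable_sources(1) law_sX]) auto
  show "AE \<omega> in M. sY \<omega> \<in> {0, 1}" by (rule *[OF measurable_sources(2) law_sY]) auto
  show "AE \<omega> in M. \<forall>k. BX k \<omega> \<in> V"
    unfolding AE_all_countable using *[OF measurable_sources(3) law_BX] by blast
  show "AE \<omega> in M. \<forall>k. BY k \<omega> \<in> V"
    unfolding AE_all_countable using *[OF measurable_sources(4) law_BY] by blast
qed

lemma AE_words: "AE \<omega> in M. word_X K \<omega> \<in> words V K" "AE \<omega> in M. word_Y K \<omega> \<in> words V K"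
  using AE_sources(3,4) by (eventually_elim; auto simp: words_def word_X_def word_Y_def)+

lemma map_upt_eq_iff: "map f [0..<K] = w \<longleftrightarrow> length w = K \<and> (\<forall>k<K. f k = w ! k)"
  by (auto simp: list_eq_iff_nth_eq)

lemma prob_X_word:
  assumes "s \<in> {0, 1}" "w \<in> words V K"
  shows "prob {\<omega> \<in> space M. sX \<omega> = s \<and> word_X K \<omega> = w} = 1 / 2 * (1 / 3) ^ K"
proof -
  let ?J = "insert SymX (LenX ` {..<K})"
  \<comment> \<open>The default \<open>{}\<close> and the entries \<open>w ! k\<close> beyond the
    end of \<open>w\<close> belong to indices outside \<open>?J\<close>.\<close>
  let ?A = "\<lambda>v. case v of SymX \<Rightarrow> {s} | LenX k \<Rightarrow> {w ! k} | _ \<Rightarrow> {}"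
  have w: "length w = K" "set w \<subseteq> V" using assms(2) by (simp_all only: words_def mem_Collect_eq)
  have wV: "w ! k \<in> V" if "k < K" for k using w that by (metis nth_mem subsetD)
  have "{\<omega> \<in> space M. sX \<omega> = s \<and> word_X K \<omega> = w} = (\<Inter>v\<in>?J. source_var v -` ?A v \<inter> space M)"
    using w(1) by (auto simp: word_X_def map_upt_eq_iff)
  also have "prob \<dots> = (\<Prod>v\<in>?J. prob (source_var v -` ?A v \<inter> space M))"
    using indep_sources unfolding source_var_def by (rule indep_varsD) auto
  also have "\<dots> = prob (sX -` {s} \<inter> space M) * (\<Prod>k<K. prob (BX k -` {w ! k} \<inter> space M))"
    by (subst prod.insert) (auto simp: prod.reindex inj_on_def)
  also have "(\<Prod>k<K. prob (BX k -` {w ! k} \<inter> space M)) = (\<Prod>k<K. 1 / 3)"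
    unfolding prob_source_var using wV card_V by (intro prod.cong) (simp_all add: pmf_of_set)
  also have "prob (sX -` {s} \<inter> space M) = 1 / 2"
    unfolding prob_source_var using assms(1) by (auto simp: pmf_of_set)
  finally show ?thesis by simp
qed

lemma prob_Y_word:
  assumes "s \<in> {0, 1}" "w \<in> words V K"
  shows "prob {\<omega> \<in> space M. sY \<omega> = s \<and> word_Y K \<omega> = w} = 1 / 2 * (1 / 3) ^ K"
proof -
  let ?J = "insert SymY (LenY ` {..<K})"
  let ?A = "\<lambda>v. case v of SymY \<Rightarrow> {s} | LenY k \<Rightarrow> {w ! k} | _ \<Rightarrow> {}"
  have w: "length w = K" "set w \<subseteq> V" using assms(2) by (simp_all only: words_def mem_Collect_eq)
  have wV: "w ! k \<in> V" if "k < K" for k using w that by (metis nth_mem subsetD)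
  have "{\<omega> \<in> space M. sY \<omega> = s \<and> word_Y K \<omega> = w} = (\<Inter>v\<in>?J. source_var v -` ?A v \<inter> space M)"
    using w(1) by (auto simp: word_Y_def map_upt_eq_iff)
  also have "prob \<dots> = (\<Prod>v\<in>?J. prob (source_var v -` ?A v \<inter> space M))"
    using indep_sources unfolding source_var_def by (rule indep_varsD) auto
  also have "\<dots> = prob (sY -` {s} \<inter> space M) * (\<Prod>k<K. prob (BY k -` {w ! k} \<inter> space M))"
    by (subst prod.insert) (auto simp: prod.reindex inj_on_def)
  also have "(\<Prod>k<K. prob (BY k -` {w ! k} \<inter> space M)) = (\<Prod>k<K. 1 / 3)"
    unfolding prob_source_var using wV card_V by (intro prod.cong) (simp_all add: pmf_of_set)
  also have "prob (sY -` {s} \<inter> space M) = 1 / 2"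
    unfolding prob_source_var using assms(1) by (auto simp: pmf_of_set)
  finally show ?thesis by simp
qed

definition X_sources :: "source set" where "X_sources = insert SymX (range LenX)"
definition Y_sources :: "source set" where "Y_sources = insert SymY (range LenY)"

text \<open>Disjoint groups of independent sources are independent. The functionals act on a whole
  group because \<open>Y n\<close> finds its blocks by an unbounded search and is not a function of
  a fixed finite word.\<close>

lemma prob_X_Y_indep:
  assumes gX: "gX \<in> measurable (PiM X_sources (\<lambda>_. count_space UNIV)) (count_space UNIV)"
    and gY: "gY \<in> measurable (PiM Y_sources (\<lambda>_. count_space UNIV)) (count_space UNIV)"
  shows "prob {\<omega> \<in> space M. gX (restrict (\<lambda>v. source_var v \<omega>) X_sources) = a
        \<and> gY (restrict (\<lambda>v. source_var v \<omega>) Y_sources) = b}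
    = prob {\<omega> \<in> space M. gX (restrict (\<lambda>v. source_var v \<omega>) X_sources) = a}
      * prob {\<omega> \<in> space M. gY (restrict (\<lambda>v. source_var v \<omega>) Y_sources) = b}"
proof -
  let ?PX = "PiM X_sources (\<lambda>_. count_space (UNIV :: nat set))"
  let ?PY = "PiM Y_sources (\<lambda>_. count_space (UNIV :: nat set))"
  let ?RX = "\<lambda>\<omega>. restrict (\<lambda>v. source_var v \<omega>) X_sources"
  let ?RY = "\<lambda>\<omega>. restrict (\<lambda>v. source_var v \<omega>) Y_sources"
  have ind: "indep_var ?PX ?RX ?PY ?RY"
    using indep_sources unfolding source_var_def
    by (rule indep_var_restrict) (auto simp: X_sources_def Y_sources_def)
  have EX: "gX -` {a} \<inter> space ?PX \<in> sets ?PX" by (rule measurable_sets[OF gX]) simp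
  have EY: "gY -` {b} \<inter> space ?PY \<in> sets ?PY" by (rule measurable_sets[OF gY]) simp
  have sp: "?RX \<omega> \<in> space ?PX" "?RY \<omega> \<in> space ?PY" for \<omega>
    by (auto simp: space_PiM)
  have "(\<lambda>\<omega>. (?RX \<omega>, ?RY \<omega>)) -` ((gX -` {a} \<inter> space ?PX) \<times> (gY -` {b} \<inter> space ?PY)) \<inter> space M
      = {\<omega> \<in> space M. gX (?RX \<omega>) = a \<and> gY (?RY \<omega>) = b}"
    "?RX -` (gX -` {a} \<inter> space ?PX) \<inter> space M = {\<omega> \<in> space M. gX (?RX \<omega>) = a}"
    "?RY -` (gY -` {b} \<inter> space ?PY) \<inter> space M = {\<omega> \<in> space M. gY (?RY \<omega>) = b}"
    using sp by auto
  with indep_varD[OF ind EX EY] show ?thesis by simp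
qed

lemma prob_X_word_Y_indep:
  assumes g: "g \<in> measurable (PiM Y_sources (\<lambda>_. count_space UNIV)) (count_space UNIV)"
    and s: "s \<in> {0, 1}" and w: "w \<in> words V K"
  shows "prob {\<omega> \<in> space M. sX \<omega> = s \<and> word_X K \<omega> = w
        \<and> g (restrict (\<lambda>v. source_var v \<omega>) Y_sources) = b}
    = 1 / 2 * (1 / 3) ^ K * prob {\<omega> \<in> space M. g (restrict (\<lambda>v. source_var v \<omega>) Y_sources) = b}"
proof -
  let ?gX = "\<lambda>f. (f SymX, map (\<lambda>k. f (LenX k)) [0..<K])"
  have "?gX \<in> measurable (PiM X_sources (\<lambda>_. count_space (UNIV :: nat set))) (count_space UNIV)"
    by (intro measurable_count_space_comp2[where F = Pair] measurable_map_upt measurable_component_singleton)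
      (auto simp: X_sources_def)
  from prob_X_Y_indep[OF this g, of "(s, w)" b] prob_X_word[OF s w]
  show ?thesis by (simp add: X_sources_def word_X_def conj_assoc)
qed

text \<open>The finite word of \<open>X\<close> is paired with the exact string \<open>Y n\<close>,
  so no error from short words of \<open>Y\<close> enters the covariance identity.\<close>

lemma prob_X_word_Y:
  assumes s: "s \<in> {0, 1}" and w: "w \<in> words V K"
  shows "prob {\<omega> \<in> space M. sX \<omega> = s \<and> word_X K \<omega> = w \<and> Y n \<omega> = y}
    = 1 / 2 * (1 / 3) ^ K * prob {\<omega> \<in> space M. Y n \<omega> = y}"
proof -
  have "(\<lambda>f. block_string (f SymY) (\<lambda>k. f (LenY k)) n)
      \<in> measurable (PiM Y_sources (\<lambda>_. count_space (UNIV :: nat set))) (count_space UNIV)"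
    by (intro measurable_block_string measurable_component_singleton) (auto simp: Y_sources_def)
  from prob_X_word_Y_indep[OF this s w, of y] show ?thesis
    by (simp add: Y_sources_def Y_eq)
qed

lemma prob_X_word_Y_word:
  assumes s: "s \<in> {0, 1}" and w: "w \<in> words V K" and s': "s' \<in> {0, 1}" and w': "w' \<in> words V K"
  shows "prob {\<omega> \<in> space M. sX \<omega> = s \<and> word_X K \<omega> = w \<and> sY \<omega> = s' \<and> word_Y K \<omega> = w'}
    = (1 / 2 * (1 / 3) ^ K) * (1 / 2 * (1 / 3) ^ K)"
proof -
  have "(\<lambda>f. (f SymY, map (\<lambda>k. f (LenY k)) [0..<K]))
      \<in> measurable (PiM Y_sources (\<lambda>_. count_space (UNIV :: nat set))) (count_space UNIV)"
    by (intro measurable_count_space_comp2[where F = Pair] measurable_map_upt measurable_component_singleton)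
      (auto simp: Y_sources_def)
  from prob_X_word_Y_indep[OF this s w, of "(s', w')"]
  have "prob {\<omega> \<in> space M. sX \<omega> = s \<and> word_X K \<omega> = w \<and> sY \<omega> = s' \<and> word_Y K \<omega> = w'}
      = 1 / 2 * (1 / 3) ^ K * prob {\<omega> \<in> space M. sY \<omega> = s' \<and> word_Y K \<omega> = w'}"
    by (simp add: Y_sources_def word_Y_def)
  then show ?thesis by (simp only: prob_Y_word[OF s' w'])
qed

end

lemma full_blocks_prefix:
  "sum_list u \<le> n \<Longrightarrow> full_blocks n (u @ r) = u @ full_blocks (n - sum_list u) r"
  by (induction u arbitrary: n) auto

text \<open>The visible string as a function of the first symbol and the full blocks: a padding
  block of length \<open>n\<close> stands for the cut rest, whose symbol is forced by
  alternation.\<close>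

definition rest_string :: "nat \<Rightarrow> nat \<Rightarrow> nat list \<Rightarrow> nat list" where
  "rest_string n s bs = take n (concat_blocks s (bs @ [n]))"

section \<open>Expectations as averages over words, and almost sure properties of the
  strings\<close>

context block_model
begin

lemma Y_in_words: "Y n \<omega> \<in> words {0, 1} n"
  by (auto simp: Y_eq words_def block_string_def block_seq_def)

lemma measurable_X_word_Y:
  "(\<lambda>\<omega>. (sX \<omega>, word_X K \<omega>, Y n \<omega>)) \<in> measurable M (count_space UNIV)"
  by (intro measurable_count_space_comp2[where F = Pair] measurable_sources measurable_word measurable_Y)

text \<open>The sum over words is innermost: the pairing of words in
  \<open>sum_modified_blocks\<close> is applied with the first symbol and the string of
  \<open>Y\<close> held fixed.\<close>

lemma expectation_X_word_Y:
  fixes G :: "nat \<Rightarrow> nat list \<Rightarrow> nat list \<Rightarrow> real"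
  shows "expectation (\<lambda>\<omega>. G (sX \<omega>) (word_X K \<omega>) (Y n \<omega>)) =
    (\<Sum>s\<in>{0, 1}. \<Sum>y\<in>words {0, 1} n.
      (1 / 2 * (1 / 3) ^ K * prob {\<omega> \<in> space M. Y n \<omega> = y}) * (\<Sum>w\<in>words V K. G s w y))"
proof -
  let ?U = "\<lambda>\<omega>. (sX \<omega>, word_X K \<omega>, Y n \<omega>)"
  let ?S = "{0, 1} \<times> words V K \<times> words {0, 1} n"
  let ?q = "\<lambda>y. 1 / 2 * (1 / 3) ^ K * prob {\<omega> \<in> space M. Y n \<omega> = y}"
  have "AE \<omega> in M. ?U \<omega> \<in> ?S"
    using AE_sources(1) AE_words(1)[of K] by eventually_elim (use Y_in_words in blast)
  moreover have "finite ?S" by (intro finite_cartesian_product finite_words) auto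
  ultimately have "expectation (\<lambda>\<omega>. (\<lambda>(s, w, y). G s w y) (?U \<omega>))
      = (\<Sum>u\<in>?S. (\<lambda>(s, w, y). G s w y) u * prob {\<omega> \<in> space M. ?U \<omega> = u})"
    by (intro expectation_finite_values[OF measurable_X_word_Y]
        measurable_compose[OF measurable_X_word_Y]) (assumption | simp)+
  also have "\<dots> = (\<Sum>(s, w, y)\<in>?S. ?q y * G s w y)"
    by (rule sum.cong[OF refl]) (auto simp: prob_X_word_Y)
  also have "\<dots> = (\<Sum>s\<in>{0, 1}. \<Sum>w\<in>words V K. \<Sum>y\<in>words {0, 1} n. ?q y * G s w y)"
    by (simp only: sum.cartesian_product[symmetric])
  also have "\<dots> = (\<Sum>s\<in>{0, 1}. \<Sum>y\<in>words {0, 1} n. \<Sum>w\<in>words V K. ?q y * G s w y)"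
    by (intro sum.cong refl sum.swap)
  finally show ?thesis by (simp only: sum_distrib_left case_prod_conv)
qed

lemma expectation_word:
  fixes g :: "nat list \<Rightarrow> real"
  assumes S: "S \<in> measurable M (count_space UNIV)" "AE \<omega> in M. S \<omega> \<in> {0, 1 :: nat}"
    and W: "W \<in> measurable M (count_space UNIV)" "AE \<omega> in M. W \<omega> \<in> words V K"
    and p: "\<And>s w. s \<in> {0, 1} \<Longrightarrow> w \<in> words V K \<Longrightarrow>
      prob {\<omega> \<in> space M. S \<omega> = s \<and> W \<omega> = w} = 1 / 2 * (1 / 3) ^ K"
  shows "expectation (\<lambda>\<omega>. g (W \<omega>)) = word_avg V K g"
proof -
  let ?U = "\<lambda>\<omega>. (S \<omega>, W \<omega>)"
  let ?S = "{0, 1 :: nat} \<times> words V K"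
  have U: "?U \<in> measurable M (count_space UNIV)"
    by (rule measurable_count_space_comp2[OF S(1) W(1)])
  have "AE \<omega> in M. ?U \<omega> \<in> ?S"
    using S(2) W(2) by eventually_elim simp
  moreover have "finite ?S" by (intro finite_cartesian_product finite_words) auto
  ultimately have "expectation (\<lambda>\<omega>. (\<lambda>(s, w). g w) (?U \<omega>))
      = (\<Sum>u\<in>?S. (\<lambda>(s, w). g w) u * prob {\<omega> \<in> space M. ?U \<omega> = u})"
    by (intro expectation_finite_values[OF U] measurable_compose[OF U]) (assumption | simp)+
  also have "\<dots> = (\<Sum>(s, w)\<in>?S. (1 / 2 * (1 / 3) ^ K) * g w)"
    by (rule sum.cong[OF refl]) (auto simp: p)
  also have "\<dots> = (\<Sum>s\<in>{0, 1 :: nat}. \<Sum>w\<in>words V K. (1 / 2 * (1 / 3) ^ K) * g w)"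
    by (simp only: sum.cartesian_product[symmetric])
  also have "\<dots> = word_avg V K g"
    unfolding sum_distrib_left[symmetric] word_avg_def card_V by (simp add: power_divide)
  finally show ?thesis by simp
qed

lemma expectation_word_X: "expectation (\<lambda>\<omega>. g (word_X K \<omega>)) = word_avg V K (g :: _ \<Rightarrow> real)"
  by (rule expectation_word[OF measurable_sources(1) AE_sources(1) measurable_word(1) AE_words(1) prob_X_word])

lemma expectation_word_Y: "expectation (\<lambda>\<omega>. g (word_Y K \<omega>)) = word_avg V K (g :: _ \<Rightarrow> real)"
  by (rule expectation_word[OF measurable_sources(2) AE_sources(2) measurable_word(2) AE_words(2) prob_Y_word])

lemma expectation_words:
  fixes G :: "nat \<Rightarrow> nat list \<Rightarrow> nat \<Rightarrow> nat list \<Rightarrow> real"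
  shows "expectation (\<lambda>\<omega>. G (sX \<omega>) (word_X K \<omega>) (sY \<omega>) (word_Y K \<omega>)) =
    (\<Sum>s\<in>{0, 1}. \<Sum>s'\<in>{0, 1}. 1 / 4 * word_avg V K (\<lambda>w. word_avg V K (\<lambda>w'. G s w s' w')))"
proof -
  let ?U = "\<lambda>\<omega>. (sX \<omega>, sY \<omega>, word_X K \<omega>, word_Y K \<omega>)"
  let ?S = "{0, 1 :: nat} \<times> {0, 1 :: nat} \<times> words V K \<times> words V K"
  have U: "?U \<in> measurable M (count_space UNIV)"
    by (intro measurable_count_space_comp2[where F = Pair] measurable_sources measurable_word)
  have "AE \<omega> in M. ?U \<omega> \<in> ?S"
    using AE_sources(1,2) AE_words[of K] by eventually_elim simp
  moreover have "finite ?S" by (intro finite_cartesian_product finite_words) auto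
  ultimately have "expectation (\<lambda>\<omega>. (\<lambda>(s, s', w, w'). G s w s' w') (?U \<omega>))
      = (\<Sum>u\<in>?S. (\<lambda>(s, s', w, w'). G s w s' w') u * prob {\<omega> \<in> space M. ?U \<omega> = u})"
    by (intro expectation_finite_values[OF U] measurable_compose[OF U]) (assumption | simp)+
  also have "\<dots> = (\<Sum>(s, s', w, w')\<in>?S. 1 / 4 * ((1 / 3) ^ K * ((1 / 3) ^ K * G s w s' w')))"
  proof (rule sum.cong[OF refl], clarify)
    fix s s' :: nat and w w' assume u: "s \<in> {0, 1}" "s' \<in> {0, 1}" "w \<in> words V K" "w' \<in> words V K"
    have "{\<omega> \<in> space M. ?U \<omega> = (s, s', w, w')}
        = {\<omega> \<in> space M. sX \<omega> = s \<and> word_X K \<omega> = w \<and> sY \<omega> = s' \<and> word_Y K \<omega> = w'}" by auto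
    then show "G s w s' w' * prob {\<omega> \<in> space M. ?U \<omega> = (s, s', w, w')}
        = 1 / 4 * ((1 / 3) ^ K * ((1 / 3) ^ K * G s w s' w'))"
      by (simp only: prob_X_word_Y_word[OF u(1,3,2,4)]) simp
  qed
  also have "\<dots> = (\<Sum>s\<in>{0, 1}. \<Sum>s'\<in>{0, 1}. \<Sum>w\<in>words V K. \<Sum>w'\<in>words V K.
      1 / 4 * ((1 / 3) ^ K * ((1 / 3) ^ K * G s w s' w')))"
    by (simp only: sum.cartesian_product[symmetric])
  also have "\<dots> = (\<Sum>s\<in>{0, 1}. \<Sum>s'\<in>{0, 1}. 1 / 4 * word_avg V K (\<lambda>w. word_avg V K (\<lambda>w'. G s w s' w')))"
  proof -
    have avg: "word_avg V K f = (\<Sum>w\<in>words V K. (1 / 3) ^ K * f w)" for f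
      unfolding word_avg_def card_V sum_distrib_left[symmetric] by (simp add: power_divide)
    show ?thesis unfolding avg by (simp only: sum_distrib_left)
  qed
  finally show ?thesis by (simp only: case_prod_conv)
qed

lemma prob_short:
  assumes "n > 0"
  shows "prob {\<omega> \<in> space M. sum_list (word_X (2 * n) \<omega>) \<le> n} \<le> 2 / real n"
    and "prob {\<omega> \<in> space M. sum_list (word_Y (2 * n) \<omega>) \<le> n} \<le> 2 / real n"
proof -
  have *: "prob {\<omega> \<in> space M. sum_list (W \<omega>) \<le> n} \<le> 2 / real n"
    if W: "W \<in> measurable M (count_space UNIV)"
      "\<And>g. expectation (\<lambda>\<omega>. g (W \<omega>)) = word_avg V (2 * n) g" for W
  proof -
    have "{\<omega> \<in> space M. sum_list (W \<omega>) \<le> n} \<in> events"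
      using measurable_sets[OF W(1), of "{w. sum_list w \<le> n}"]
      by (simp add: vimage_def Int_def conj_commute)
    then have "prob {\<omega> \<in> space M. sum_list (W \<omega>) \<le> n}
        = expectation (indicator {\<omega> \<in> space M. sum_list (W \<omega>) \<le> n})" by simp
    also have "\<dots> = expectation (\<lambda>\<omega>. if sum_list (W \<omega>) \<le> n then 1 else 0)"
      by (rule Bochner_Integration.integral_cong) (auto simp: indicator_def)
    also have "\<dots> = word_avg V (2 * n) (\<lambda>w. if sum_list w \<le> n then 1 else 0)"
      by (rule W(2))
    also have "\<dots> \<le> 2 / real n" by (rule word_avg_short[OF l_pos refl assms])
    finally show ?thesis .
  qed
  show "prob {\<omega> \<in> space M. sum_list (word_X (2 * n) \<omega>) \<le> n} \<le> 2 / real n"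
    by (rule *[OF measurable_word(1) expectation_word_X])
  show "prob {\<omega> \<in> space M. sum_list (word_Y (2 * n) \<omega>) \<le> n} \<le> 2 / real n"
    by (rule *[OF measurable_word(2) expectation_word_Y])
qed

text \<open>If no partial sum exceeded \<open>m\<close>, the first \<open>2 n\<close> blocks would
  be short for every \<open>n >= m\<close>, an event of probability at most
  \<open>2 / n\<close>.\<close>

lemma AE_word_X_unbounded: "AE \<omega> in M. \<forall>m. \<exists>K. m < sum_list (word_X K \<omega>)"
  unfolding AE_all_countable
proof
  fix m
  have ev: "{\<omega> \<in> space M. sum_list (word_X K \<omega>) \<le> n} \<in> events" for K n
    using measurable_sets[OF measurable_word(1)[of K], of "{w. sum_list w \<le> n}"]
    by (simp add: vimage_def Int_def conj_commute)
  let ?E = "{\<omega> \<in> space M. \<forall>K. sum_list (word_X K \<omega>) \<le> m}"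
  have "?E = (\<Inter>K. {\<omega> \<in> space M. sum_list (word_X K \<omega>) \<le> m})" by auto
  then have E: "?E \<in> events" using ev by (simp add: sets.countable_INT')
  have le: "prob ?E \<le> 2 / real n" if "n > 0" "n \<ge> m" for n
  proof -
    have "prob ?E \<le> prob {\<omega> \<in> space M. sum_list (word_X (2 * n) \<omega>) \<le> n}"
      using that(2) by (intro finite_measure_mono ev) (auto intro: order_trans)
    then show ?thesis using prob_short(1)[OF that(1)] by linarith
  qed
  have "prob ?E = 0"
  proof (rule ccontr)
    assume "prob ?E \<noteq> 0"
    then have pos: "prob ?E > 0" using measure_nonneg[of M ?E] by linarith
    obtain n :: nat where n: "2 / prob ?E < real n" using reals_Archimedean2 by blast
    let ?n = "max n (max m 1)"
    have "2 / prob ?E < real ?n" using n by linarith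
    then have "2 / real ?n < prob ?E" using pos by (simp add: field_simps)
    moreover have "prob ?E \<le> 2 / real ?n" by (rule le) auto
    ultimately show False by linarith
  qed
  then show "AE \<omega> in M. \<exists>K. m < sum_list (word_X K \<omega>)"
    using prob_Collect_eq_0[of "\<lambda>\<omega>. \<forall>K. sum_list (word_X K \<omega>) \<le> m"] E by (simp add: not_le)
qed

lemma word_X_append:
  "K \<le> K' \<Longrightarrow> word_X K' \<omega> = word_X K \<omega> @ map (\<lambda>k. BX k \<omega>) [K..<K']"
  unfolding word_X_def by (metis le_add_diff_inverse map_append upt_add_eq_append zero_le)

lemma length_word_X [simp]: "length (word_X K \<omega>) = K"
  by (simp add: word_X_def)

lemma nth_word_X [simp]: "k < K \<Longrightarrow> word_X K \<omega> ! k = BX k \<omega>"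
  by (simp add: word_X_def)

lemma X_eq_take: "n \<le> sum_list (word_X K \<omega>) \<Longrightarrow> X n \<omega> = take n (concat_blocks (sX \<omega>) (word_X K \<omega>))"
  unfolding X_eq by (rule block_string_eq_take) simp_all

lemma Y_eq_take: "n \<le> sum_list (word_Y K \<omega>) \<Longrightarrow> Y n \<omega> = take n (concat_blocks (sY \<omega>) (word_Y K \<omega>))"
  unfolding Y_eq by (rule block_string_eq_take) (simp_all add: word_Y_def)

lemma blocks_X_eq:
  "n < sum_list (word_X K \<omega>) \<Longrightarrow> blocks (\<lambda>k. BX k \<omega>) n = full_blocks n (word_X K \<omega>)"
  by (rule blocks_eq_full_blocks) simp_all

lemma X_eq_rest_string:
  "n < sum_list (word_X K \<omega>) \<Longrightarrow> X n \<omega> = rest_string n (sX \<omega>) (full_blocks n (word_X K \<omega>))"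
  unfolding rest_string_def
  by (subst X_eq_take[of n K]) (simp, rule take_concat_full_blocks, simp_all)

text \<open>All lengths lie within 1 of \<open>l\<close>, so each of the two replacements moves the
  common subsequence length by at most 1, wherever \<open>I n\<close> and \<open>J n\<close>
  point.\<close>

lemma AE_lcs_modified:
  "AE \<omega> in M. \<bar>real (lcs (X' n \<omega>) (Y n \<omega>)) - real (lcs (X n \<omega>) (Y n \<omega>))\<bar> \<le> 2"
  using AE_word_X_unbounded AE_sources(3)
proof eventually_elim
  case (elim \<omega>)
  let ?b = "\<lambda>k. BX k \<omega>" and ?i = "I n \<omega>" and ?j = "J n \<omega>"
  show ?case
  proof (cases "modify_blocks l n ?b ?i ?j = ?b")
    case True
    then have "X' n \<omega> = X n \<omega>" by (simp add: X_eq X'_eq)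
    then show ?thesis by simp
  next
    case False
    then have mod: "modify_blocks l n ?b ?i ?j = ?b(?i := l, ?j := l)"
      by (auto simp: modify_blocks_def split: if_splits)
    \<comment> \<open>Replacements at arbitrary indices may shorten the total by up to 2; the
      reserve keeps \<open>n\<close> positions covered. \<open>K\<close> also exceeds both indices,
      so that the replacements happen inside the word.\<close>
    obtain K0 where K0: "n + 2 < sum_list (word_X K0 \<omega>)" using elim(1) by blast
    define K where "K = max K0 (Suc (max ?i ?j))"
    have K: "?i < K" "?j < K" "K0 \<le> K" by (auto simp: K_def)
    define w where "w = word_X K \<omega>"
    have len: "length w = K" by (simp add: w_def)
    have sum: "n + 2 < sum_list w" using K0 word_X_append[OF K(3)] by (simp add: w_def)
    have near: "w ! k \<le> l + 1" "l \<le> w ! k + 1" if "k < K" for k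
    proof -
      have "w ! k \<in> V" using elim(2) that by (simp add: w_def)
      then show "w ! k \<le> l + 1" "l \<le> w ! k + 1" by auto
    qed
    have le: "u ! k \<le> sum_list u" if "k < length u" for u :: "nat list" and k
      using that by (simp add: elem_le_sum_list)
    let ?v = "w[?i := l]"
    have vj: "?v ! ?j \<le> l + 1" "l \<le> ?v ! ?j + 1"
      using near K len by (auto simp: nth_list_update)
    have "sum_list w \<le> sum_list ?v + 1"
      using near[OF K(1)] le[of ?i w] K(1) len by (simp add: sum_list_update)
    moreover have "sum_list ?v \<le> sum_list (?v[?j := l]) + 1"
      using vj le[of ?j ?v] K(2) len by (simp add: sum_list_update)
    ultimately have sum': "n \<le> sum_list (?v[?j := l])" using sum by simp
    have "X' n \<omega> = take n (concat_blocks (sX \<omega>) (?v[?j := l]))"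
      unfolding X'_eq mod
      by (rule block_string_eq_take[OF sum']) (auto simp: nth_list_update len w_def)
    moreover have "X n \<omega> = take n (concat_blocks (sX \<omega>) w)"
      unfolding w_def by (rule X_eq_take) (use sum in \<open>simp add: w_def\<close>)
    moreover have "\<bar>int (lcs (take n (concat_blocks (sX \<omega>) ?v)) (Y n \<omega>))
        - int (lcs (take n (concat_blocks (sX \<omega>) w)) (Y n \<omega>))\<bar> \<le> int 1"
      by (rule lcs_block_update) (use near[OF K(1)] K len in auto)
    moreover have "\<bar>int (lcs (take n (concat_blocks (sX \<omega>) (?v[?j := l]))) (Y n \<omega>))
        - int (lcs (take n (concat_blocks (sX \<omega>) ?v)) (Y n \<omega>))\<bar> \<le> int 1"
      by (rule lcs_block_update) (use vj K len in auto)
    ultimately show ?thesis by simp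
  qed
qed

end

section \<open>The law of the modification\<close>

text \<open>Fewer full blocks than letters of \<open>u\<close> means that the overshooting block
  already lies in \<open>u\<close>, so the extension \<open>r\<close> is never reached.\<close>

lemma full_blocks_eq_longer:
  assumes "full_blocks n (u @ r) = bs" "length bs < length u"
  shows "n < sum_list u" "full_blocks n u = bs"
proof -
  show n: "n < sum_list u"
  proof (rule ccontr)
    assume "\<not> n < sum_list u"
    then show False using full_blocks_prefix[of u n r] assms by simp
  qed
  obtain x v where v: "u = full_blocks n u @ x # v" "n < sum_list (full_blocks n u) + x"
    by (rule full_blocks_decomp_Cons[OF n])
  have "full_blocks n (full_blocks n u @ x # v @ r) = full_blocks n u"
    by (rule full_blocks_append) (use v(2) sum_full_blocks_le in auto)
  then show "full_blocks n u = bs" using assms(1) v(1) by (metis append_Cons append_assoc)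
qed

context block_model
begin

abbreviation short_blocks :: "nat list \<Rightarrow> nat set" where
  "short_blocks bs \<equiv> blocks_of_length (l - 1) bs"

abbreviation long_blocks :: "nat list \<Rightarrow> nat set" where
  "long_blocks bs \<equiv> blocks_of_length (l + 1) bs"

abbreviation blocks_X :: "nat \<Rightarrow> 'a \<Rightarrow> nat list" where
  "blocks_X n \<omega> \<equiv> blocks (\<lambda>k. BX k \<omega>) n"

lemma events_of_measurable:
  assumes "U \<in> measurable M (count_space UNIV)"
  shows "{\<omega> \<in> space M. P (U \<omega>)} \<in> events"
  using measurable_sets[OF assms, of "{u. P u}"] by (simp add: vimage_def Int_def conj_commute)

lemma measurable_observed:
  "(\<lambda>\<omega>. (X n \<omega>, blocks_X n \<omega>, Y n \<omega>, I n \<omega>, J n \<omega>)) \<in> measurable M (count_space UNIV)"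
  by (intro measurable_count_space_comp2[where F = Pair] measurable_X measurable_blocks_X measurable_Y
      measurable_I measurable_J)

lemma events_observed:
  "{\<omega> \<in> space M. P (X n \<omega>) (blocks_X n \<omega>) (Y n \<omega>) (I n \<omega>) (J n \<omega>)} \<in> events"
  using events_of_measurable[OF measurable_observed, of "\<lambda>(x, bs, y, i, j). P x bs y i j"] by simp

text \<open>The pair is uniform on \<open>a c\<close> possibilities; clearing the denominators gives
  a form that also covers observations of probability zero.\<close>

lemma prob_choice:
  assumes i: "i \<in> short_blocks bs" and j: "j \<in> long_blocks bs"
  shows "real (card (short_blocks bs)) * real (card (long_blocks bs))
      * prob {\<omega> \<in> space M. X n \<omega> = x \<and> blocks_X n \<omega> = bs \<and> Y n \<omega> = y \<and> I n \<omega> = i \<and> J n \<omega> = j}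
    = prob {\<omega> \<in> space M. X n \<omega> = x \<and> blocks_X n \<omega> = bs \<and> Y n \<omega> = y}"
    (is "?a * ?c * prob ?F = prob ?E")
proof (cases "prob ?E = 0")
  case True
  have "prob ?F \<le> prob ?E"
    by (rule finite_measure_mono[OF _ events_observed]) auto
  then have "prob ?F = 0" using True measure_nonneg[of M ?F] by linarith
  then show ?thesis using True by simp
next
  case False
  then have pos: "prob ?E > 0" using measure_nonneg[of M ?E] by linarith
  have ne: "short_blocks bs \<noteq> {}" "long_blocks bs \<noteq> {}" using i j by auto
  have "prob {\<omega> \<in> space M. (I n \<omega> = i \<and> J n \<omega> = j) \<and> X n \<omega> = x \<and> blocks_X n \<omega> = bs \<and> Y n \<omega> = y}
      / prob ?E = pmf (pmf_of_set (short_blocks bs)) i * pmf (pmf_of_set (long_blocks bs)) j"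
    using choice_law[OF pos ne, of i j] by (simp only: cond_prob_def)
  also have "{\<omega> \<in> space M. (I n \<omega> = i \<and> J n \<omega> = j) \<and> X n \<omega> = x \<and> blocks_X n \<omega> = bs \<and> Y n \<omega> = y} = ?F"
    by auto
  also have "pmf (pmf_of_set (short_blocks bs)) i * pmf (pmf_of_set (long_blocks bs)) j = 1 / (?a * ?c)"
    using i j ne by (simp add: pmf_of_set del: One_nat_def add_Suc_right Nat.add_0_right)
  finally have "prob ?F / prob ?E = 1 / (?a * ?c)" .
  moreover have "?a * ?c > 0" using ne by (simp add: card_gt_0_iff)
  moreover have "c * f = e" if "f / e = 1 / c" "c > 0" "e > 0" for c e f :: real
    using that by (simp add: field_simps)
  ultimately show ?thesis using pos by blast
qed

text \<open>The admissible pairs already exhaust the probability of each observation, so the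
  remainder is null, and there are only countably many observations.\<close>

lemma AE_choice:
  "AE \<omega> in M. short_blocks (blocks_X n \<omega>) \<noteq> {} \<and> long_blocks (blocks_X n \<omega>) \<noteq> {} \<longrightarrow>
    I n \<omega> \<in> short_blocks (blocks_X n \<omega>) \<and> J n \<omega> \<in> long_blocks (blocks_X n \<omega>)"
proof -
  have "AE \<omega> in M. \<not> (X n \<omega> = x \<and> blocks_X n \<omega> = bs \<and> Y n \<omega> = y
      \<and> \<not> (I n \<omega> \<in> short_blocks bs \<and> J n \<omega> \<in> long_blocks bs))"
    if ne: "short_blocks bs \<noteq> {}" "long_blocks bs \<noteq> {}" for x bs y
  proof -
    let ?E = "{\<omega> \<in> space M. X n \<omega> = x \<and> blocks_X n \<omega> = bs \<and> Y n \<omega> = y}"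
    let ?F = "\<lambda>(i, j). {\<omega> \<in> space M. X n \<omega> = x \<and> blocks_X n \<omega> = bs \<and> Y n \<omega> = y \<and> I n \<omega> = i \<and> J n \<omega> = j}"
    let ?P = "short_blocks bs \<times> long_blocks bs"
    let ?c = "real (card (short_blocks bs)) * real (card (long_blocks bs))"
    have c: "?c > 0" using ne by (simp add: card_gt_0_iff)
    have "prob (\<Union>p\<in>?P. ?F p) = (\<Sum>p\<in>?P. prob (?F p))"
      by (rule finite_measure_finite_Union) (auto simp: disjoint_family_on_def intro!: events_observed)
    also have "\<dots> = (\<Sum>p\<in>?P. prob ?E / ?c)"
    proof (rule sum.cong[OF refl])
      fix p assume "p \<in> ?P"
      then obtain i j where p: "p = (i, j)" "i \<in> short_blocks bs" "j \<in> long_blocks bs" by auto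
      have "prob ?E = ?c * prob (?F p)" unfolding p(1) prod.case using prob_choice[OF p(2,3)] by simp
      moreover have "f = e / c" if "e = c * f" "c > 0" for c e f :: real using that by simp
      ultimately show "prob (?F p) = prob ?E / ?c" using c by blast
    qed
    also have "\<dots> = prob ?E" using ne by (simp add: card_cartesian_product)
    finally have eq: "prob (\<Union>p\<in>?P. ?F p) = prob ?E" .
    have "{\<omega> \<in> space M. X n \<omega> = x \<and> blocks_X n \<omega> = bs \<and> Y n \<omega> = y
        \<and> \<not> (I n \<omega> \<in> short_blocks bs \<and> J n \<omega> \<in> long_blocks bs)} = ?E - (\<Union>p\<in>?P. ?F p)"
      (is "?D = _") by auto
    moreover have "prob (?E - (\<Union>p\<in>?P. ?F p)) = prob ?E - prob (\<Union>p\<in>?P. ?F p)"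
      by (rule finite_measure_Diff) (auto intro!: events_observed sets.finite_UN)
    ultimately have "prob ?D = 0" using eq by (simp only: diff_self)
    moreover have "?D \<in> events"
      by (rule events_observed[of "\<lambda>x' bs' y' i j. x' = x \<and> bs' = bs \<and> y' = y
          \<and> \<not> (i \<in> short_blocks bs \<and> j \<in> long_blocks bs)"])
    ultimately show ?thesis by (simp only: prob_Collect_eq_0)
  qed
  then have "AE \<omega> in M. \<forall>x bs y. short_blocks bs \<noteq> {} \<longrightarrow> long_blocks bs \<noteq> {} \<longrightarrow>
      \<not> (X n \<omega> = x \<and> blocks_X n \<omega> = bs \<and> Y n \<omega> = y
      \<and> \<not> (I n \<omega> \<in> short_blocks bs \<and> J n \<omega> \<in> long_blocks bs))"
    unfolding AE_all_countable by (intro allI AE_impI) auto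
  then show ?thesis by eventually_elim blast
qed

text \<open>Up to a null set, conditioning on the visible string and its blocks is the same as conditioning
  on the first symbol and the blocks.\<close>

lemma AE_observed_iff:
  assumes n: "n > 0"
  shows "AE \<omega> in M. \<forall>s\<in>{0, 1}. \<forall>bs. length bs < K \<longrightarrow>
    (sX \<omega> = s \<and> n < sum_list (word_X K \<omega>) \<and> full_blocks n (word_X K \<omega>) = bs
      \<longleftrightarrow> X n \<omega> = rest_string n s bs \<and> blocks_X n \<omega> = bs)"
  using AE_word_X_unbounded AE_sources(1)
proof eventually_elim
  case (elim \<omega>)
  show ?case
  proof (intro ballI allI impI iffI)
    fix s :: nat and bs :: "nat list" assume "s \<in> {0, 1}" "length bs < K"
      "sX \<omega> = s \<and> n < sum_list (word_X K \<omega>) \<and> full_blocks n (word_X K \<omega>) = bs"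
    then show "X n \<omega> = rest_string n s bs \<and> blocks_X n \<omega> = bs"
      using X_eq_rest_string[of n K \<omega>] blocks_X_eq[of n K \<omega>] by simp
  next
    fix s :: nat and bs :: "nat list"
    assume s: "s \<in> {0, 1}" and bs: "length bs < K"
      and h: "X n \<omega> = rest_string n s bs \<and> blocks_X n \<omega> = bs"
    obtain K0 where K0: "n < sum_list (word_X K0 \<omega>)" using elim(1) by blast
    \<comment> \<open>The blocks of \<open>X\<close> are identified with full blocks on a word long
      enough to pass \<open>n\<close>; the bound on \<open>length bs\<close> then brings the
      overshooting block back into the first \<open>K\<close> letters.\<close>
    let ?K = "max K0 K"
    have big: "n < sum_list (word_X ?K \<omega>)"
      using K0 word_X_append[of K0 ?K \<omega>] by simp
    have "full_blocks n (word_X K \<omega> @ map (\<lambda>k. BX k \<omega>) [K..<?K]) = bs"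
      using blocks_X_eq[OF big] h word_X_append[of K ?K \<omega>] by simp
    from full_blocks_eq_longer[OF this] bs
    have w: "n < sum_list (word_X K \<omega>)" "full_blocks n (word_X K \<omega>) = bs" by simp_all
    have "rest_string n (sX \<omega>) bs = rest_string n s bs"
      using X_eq_rest_string[OF w(1)] w(2) h by simp
    then have "sX \<omega> mod 2 = s mod 2"
      unfolding rest_string_def by (rule concat_blocks_symbol_inj[OF n])
    then have "sX \<omega> = s" using s elim(2) by auto
    then show "sX \<omega> = s \<and> n < sum_list (word_X K \<omega>) \<and> full_blocks n (word_X K \<omega>) = bs" using w by simp
  qed
qed

lemma X'_eq_rest_string:
  assumes w: "n < sum_list (word_X K \<omega>)"
    and i: "I n \<omega> \<in> short_blocks (full_blocks n (word_X K \<omega>))"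
    and j: "J n \<omega> \<in> long_blocks (full_blocks n (word_X K \<omega>))"
  shows "X' n \<omega> = rest_string n (sX \<omega>) ((full_blocks n (word_X K \<omega>))[I n \<omega> := l, J n \<omega> := l])"
proof -
  let ?w = "word_X K \<omega>" and ?i = "I n \<omega>" and ?j = "J n \<omega>"
  let ?w' = "?w[?i := l, ?j := l]"
  have nth: "full_blocks n ?w ! k = ?w ! k" if "k < length (full_blocks n ?w)" for k
    by (metis full_blocks_decomp nth_append that)
  have ij: "?i < length (full_blocks n ?w)" "?j < length (full_blocks n ?w)"
    "?w ! ?i = l - 1" "?w ! ?j = l + 1"
    using i j nth by (auto simp: blocks_of_length_def)
  have ne: "?i \<noteq> ?j" using ij(3,4) by auto
  have "l + l = ?w ! ?i + ?w ! ?j" using ij(3,4) l_pos by simp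
  note u = full_blocks_update2[OF ij(1,2) ne this]
  have "modify_blocks l n (\<lambda>k. BX k \<omega>) ?i ?j = (\<lambda>k. BX k \<omega>)(?i := l, ?j := l)"
    using i j blocks_X_eq[OF w] by (auto simp: modify_blocks_def)
  then have "X' n \<omega> = block_string (sX \<omega>) ((\<lambda>k. BX k \<omega>)(?i := l, ?j := l)) n"
    by (simp add: X'_eq)
  also have "\<dots> = take n (concat_blocks (sX \<omega>) ?w')"
    by (rule block_string_eq_take) (use w u(2) in \<open>auto simp: nth_list_update\<close>)
  also have "\<dots> = rest_string n (sX \<omega>) (full_blocks n ?w')"
    unfolding rest_string_def by (rule take_concat_full_blocks) (use w u(2) in auto)
  finally show ?thesis using u(1) by simp
qed

text \<open>The weight \<open>a c\<close> turns the mean over the chosen pair into a plain sum over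
  all pairs; for a fixed first symbol and string of \<open>Y\<close> the pairing of words replaces
  this sum by \<open>m (m - 1)\<close> copies of the unmodified term.\<close>

lemma expectation_weight_modified:
  assumes n: "n > 0"
  shows "expectation (\<lambda>\<omega>. block_weight l n (word_X K \<omega>) * real (lcs (X' n \<omega>) (Y n \<omega>)))
    = expectation (\<lambda>\<omega>. (block_weight l n (word_X K \<omega>) + block_score l n (word_X K \<omega>))
        * real (lcs (X n \<omega>) (Y n \<omega>)))"
proof -
  define lc where "lc s bs y = real (lcs (rest_string n s bs) y)" for s bs y
  let ?bl = "\<lambda>\<omega>. full_blocks n (word_X K \<omega>)"
  let ?ok = "\<lambda>\<omega>. n < sum_list (word_X K \<omega>)"
  define pairs where "pairs bs = short_blocks bs \<times> long_blocks bs" for bs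
  define c where "c bs = real (card (short_blocks bs)) * real (card (long_blocks bs))" for bs
  define BS where "BS = full_blocks n ` {w \<in> words V K. n < sum_list w}"
  define S where "S = {0, 1 :: nat} \<times> BS \<times> words {0, 1 :: nat} n"
  define P where "P = (SIGMA (s, bs, y) : S. pairs bs)"
  \<comment> \<open>\<open>W\<close> records the observation, \<open>U\<close> adds the chosen pair.
    \<open>None\<close> stands for words that are too short and, in \<open>U\<close>, also for words
    without an admissible pair, where the weight vanishes.\<close>
  define W where "W \<omega> = (if ?ok \<omega> then Some (sX \<omega>, ?bl \<omega>, Y n \<omega>) else None)" for \<omega>
  define U where "U \<omega> = (if ?ok \<omega> \<and> pairs (?bl \<omega>) \<noteq> {}
      then Some ((sX \<omega>, ?bl \<omega>, Y n \<omega>), (I n \<omega>, J n \<omega>)) else None)" for \<omega>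
  define \<phi> where "\<phi> u = (case u of None \<Rightarrow> 0
      | Some ((s, bs, y), (i, j)) \<Rightarrow> c bs * lc s (bs[i := l, j := l]) y)" for u
  define \<psi> where "\<psi> u = (case u of None \<Rightarrow> 0
      | Some (s, bs, y) \<Rightarrow> \<Sum>(i, j)\<in>pairs bs. lc s (bs[i := l, j := l]) y)" for u
  define G1 where "G1 s w y = (if n < sum_list w
      then \<Sum>(i, j)\<in>pairs (full_blocks n w). lc s ((full_blocks n w)[i := l, j := l]) y else 0)" for s w y
  define G2 where "G2 s w y = (if n < sum_list w
      then real (card (blocks_of_length l (full_blocks n w)))
        * (real (card (blocks_of_length l (full_blocks n w))) - 1) * lc s (full_blocks n w) y else 0)" for s w y
  have finS: "finite S"
  proof -
    have V: "finite {w \<in> words V K. n < sum_list w}"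
      by (rule finite_subset[OF _ finite_words[of V K]]) auto
    have "finite (words {0, 1 :: nat} n)" by (rule finite_words) simp
    then show ?thesis unfolding S_def BS_def
      by (intro finite_cartesian_product finite_imageI V finite.intros)
  qed
  have finp: "finite (pairs bs)" for bs by (simp add: pairs_def)
  have finP: "finite P" unfolding P_def using finS finp by (intro finite_SigmaI) auto
  have mW: "W \<in> measurable M (count_space UNIV)"
    using measurable_compose[OF measurable_X_word_Y[of K n],
        of "\<lambda>(s, w, y). if n < sum_list w then Some (s, full_blocks n w, y) else None"]
    by (simp add: W_def[abs_def])
  have mU: "U \<in> measurable M (count_space UNIV)"
  proof -
    have "(\<lambda>\<omega>. (I n \<omega>, J n \<omega>)) \<in> measurable M (count_space UNIV)"
      by (rule measurable_count_space_comp2[OF measurable_I measurable_J])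
    from measurable_count_space_comp2[OF measurable_X_word_Y[of K n] this]
    have "(\<lambda>\<omega>. (\<lambda>(s, w, y) ij. if n < sum_list w \<and> pairs (full_blocks n w) \<noteq> {}
        then Some ((s, full_blocks n w, y), ij) else None) (sX \<omega>, word_X K \<omega>, Y n \<omega>) (I n \<omega>, J n \<omega>))
      \<in> measurable M (count_space UNIV)" .
    then show ?thesis unfolding U_def prod.case .
  qed
  have BS: "length bs < K" if "bs \<in> BS" for bs
    using that length_full_blocks_less by (auto simp: BS_def words_def)
  have inS: "AE \<omega> in M. ?ok \<omega> \<longrightarrow> (sX \<omega>, ?bl \<omega>, Y n \<omega>) \<in> S"
    using AE_sources(1) AE_words(1)[of K]
    by eventually_elim (use Y_in_words in \<open>auto simp: S_def BS_def\<close>)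
  have choice: "AE \<omega> in M. ?ok \<omega> \<longrightarrow> pairs (?bl \<omega>) \<noteq> {} \<longrightarrow> (I n \<omega>, J n \<omega>) \<in> pairs (?bl \<omega>)"
    using AE_choice[of n] by eventually_elim (auto simp: pairs_def blocks_X_eq)
  \<comment> \<open>Both events are traded, up to null sets, for events about \<open>X n\<close>,
    its blocks and \<open>Y n\<close>, the form in which the law of the choice is given.\<close>
  have probs: "c bs * prob {\<omega> \<in> space M. U \<omega> = Some ((s, bs, y), (i, j))}
      = prob {\<omega> \<in> space M. W \<omega> = Some (s, bs, y)}"
    if s: "s \<in> {0, 1}" and bs: "bs \<in> BS" and ij: "(i, j) \<in> pairs bs" for s bs y i j
  proof -
    have 1: "prob {\<omega> \<in> space M. W \<omega> = Some (s, bs, y)}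
        = prob {\<omega> \<in> space M. X n \<omega> = rest_string n s bs \<and> blocks_X n \<omega> = bs \<and> Y n \<omega> = y}"
    proof (rule finite_measure_eq_AE)
      show "AE \<omega> in M. (\<omega> \<in> {\<omega> \<in> space M. W \<omega> = Some (s, bs, y)}) \<longleftrightarrow>
          (\<omega> \<in> {\<omega> \<in> space M. X n \<omega> = rest_string n s bs \<and> blocks_X n \<omega> = bs \<and> Y n \<omega> = y})"
        using AE_observed_iff[OF n, of K]
        by eventually_elim (use s BS[OF bs] in \<open>auto simp: W_def split: if_splits\<close>)
    qed (intro events_of_measurable[OF mW] events_observed)+
    have 2: "prob {\<omega> \<in> space M. U \<omega> = Some ((s, bs, y), (i, j))}
        = prob {\<omega> \<in> space M. X n \<omega> = rest_string n s bs \<and> blocks_X n \<omega> = bs \<and> Y n \<omega> = y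
            \<and> I n \<omega> = i \<and> J n \<omega> = j}"
    proof (rule finite_measure_eq_AE)
      show "AE \<omega> in M. (\<omega> \<in> {\<omega> \<in> space M. U \<omega> = Some ((s, bs, y), (i, j))}) \<longleftrightarrow>
          (\<omega> \<in> {\<omega> \<in> space M. X n \<omega> = rest_string n s bs \<and> blocks_X n \<omega> = bs \<and> Y n \<omega> = y
            \<and> I n \<omega> = i \<and> J n \<omega> = j})"
        using AE_observed_iff[OF n, of K]
        by eventually_elim (use s BS[OF bs] ij in \<open>auto simp: U_def split: if_splits\<close>)
    qed (intro events_of_measurable[OF mU] events_observed)+
    have "i \<in> short_blocks bs" "j \<in> long_blocks bs" using ij by (simp_all add: pairs_def)
    then show ?thesis unfolding 1 2 c_def by (rule prob_choice)
  qed
  have "expectation (\<lambda>\<omega>. block_weight l n (word_X K \<omega>) * real (lcs (X' n \<omega>) (Y n \<omega>)))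
      = expectation (\<lambda>\<omega>. \<phi> (U \<omega>))"
  proof (rule integral_cong_AE)
    have "(\<lambda>\<omega>. (word_X K \<omega>, X' n \<omega>, Y n \<omega>)) \<in> measurable M (count_space UNIV)"
      by (intro measurable_count_space_comp2[where F = Pair] measurable_word measurable_X' measurable_Y)
    from measurable_compose[OF this, of "\<lambda>(w, x, y). block_weight l n w * real (lcs x y)" borel]
    show "(\<lambda>\<omega>. block_weight l n (word_X K \<omega>) * real (lcs (X' n \<omega>) (Y n \<omega>))) \<in> borel_measurable M"
      by simp
    show "(\<lambda>\<omega>. \<phi> (U \<omega>)) \<in> borel_measurable M" by (rule measurable_compose[OF mU]) simp
    show "AE \<omega> in M. block_weight l n (word_X K \<omega>) * real (lcs (X' n \<omega>) (Y n \<omega>)) = \<phi> (U \<omega>)"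
      using choice
    proof eventually_elim
      case (elim \<omega>)
      show ?case
      proof (cases "?ok \<omega> \<and> pairs (?bl \<omega>) \<noteq> {}")
        case True
        then have ij: "I n \<omega> \<in> short_blocks (?bl \<omega>)" "J n \<omega> \<in> long_blocks (?bl \<omega>)"
          using elim by (auto simp: pairs_def)
        show ?thesis
          using True X'_eq_rest_string[OF conjunct1[OF True] ij]
          by (simp add: U_def \<phi>_def lc_def c_def block_weight_def)
      next
        case False
        then have "block_weight l n (word_X K \<omega>) = 0"
          by (auto simp: block_weight_def pairs_def)
        moreover have "\<phi> (U \<omega>) = 0" unfolding U_def if_not_P[OF False] by (simp add: \<phi>_def)
        ultimately show ?thesis by simp
      qed
    qed
  qed
  also have "\<dots> = (\<Sum>u\<in>insert None (Some ` P). \<phi> u * prob {\<omega> \<in> space M. U \<omega> = u})"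
  proof (rule expectation_finite_values[OF mU])
    show "AE \<omega> in M. U \<omega> \<in> insert None (Some ` P)"
      using inS choice by eventually_elim (auto simp: U_def P_def)
    show "(\<lambda>\<omega>. \<phi> (U \<omega>)) \<in> borel_measurable M" by (rule measurable_compose[OF mU]) simp
  qed (use finP in simp)
  also have "\<dots> = (\<Sum>p\<in>P. \<phi> (Some p) * prob {\<omega> \<in> space M. U \<omega> = Some p})"
    using finP by (subst sum.insert) (auto simp: \<phi>_def sum.reindex)
  also have "\<dots> = (\<Sum>q\<in>S. \<Sum>p\<in>(case q of (s, bs, y) \<Rightarrow> pairs bs).
      \<phi> (Some (q, p)) * prob {\<omega> \<in> space M. U \<omega> = Some (q, p)})"
    unfolding P_def using finS finp by (subst sum.Sigma) (auto simp: case_prod_unfold)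
  \<comment> \<open>The factor \<open>c bs\<close> inside \<open>\<phi>\<close> meets the
    probability of each value of \<open>U\<close> and leaves the probability of the value of
    \<open>W\<close>, the same for all pairs.\<close>
  also have "\<dots> = (\<Sum>q\<in>S. \<psi> (Some q) * prob {\<omega> \<in> space M. W \<omega> = Some q})"
  proof (rule sum.cong[OF refl])
    fix q assume "q \<in> S"
    then obtain s bs y where q: "q = (s, bs, y)" "s \<in> {0, 1}" "bs \<in> BS" by (auto simp: S_def)
    have "(\<Sum>p\<in>pairs bs. \<phi> (Some (q, p)) * prob {\<omega> \<in> space M. U \<omega> = Some (q, p)})
        = (\<Sum>p\<in>pairs bs. (case p of (i, j) \<Rightarrow> lc s (bs[i := l, j := l]) y)
            * prob {\<omega> \<in> space M. W \<omega> = Some q})"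
    proof (rule sum.cong[OF refl])
      fix p assume p: "p \<in> pairs bs"
      obtain i j where ij: "p = (i, j)" by (cases p)
      show "\<phi> (Some (q, p)) * prob {\<omega> \<in> space M. U \<omega> = Some (q, p)}
          = (case p of (i, j) \<Rightarrow> lc s (bs[i := l, j := l]) y) * prob {\<omega> \<in> space M. W \<omega> = Some q}"
        using probs[OF q(2,3) p[unfolded ij], of y, symmetric] unfolding q(1) ij
        by (simp add: \<phi>_def)
    qed
    then show "(\<Sum>p\<in>(case q of (s, bs, y) \<Rightarrow> pairs bs).
        \<phi> (Some (q, p)) * prob {\<omega> \<in> space M. U \<omega> = Some (q, p)})
        = \<psi> (Some q) * prob {\<omega> \<in> space M. W \<omega> = Some q}"
      by (simp add: q(1) \<psi>_def sum_distrib_right)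
  qed
  also have "\<dots> = (\<Sum>u\<in>insert None (Some ` S). \<psi> u * prob {\<omega> \<in> space M. W \<omega> = u})"
    using finS by (subst sum.insert) (auto simp: \<psi>_def sum.reindex)
  also have "\<dots> = expectation (\<lambda>\<omega>. \<psi> (W \<omega>))"
  proof (rule expectation_finite_values[OF mW, symmetric])
    show "AE \<omega> in M. W \<omega> \<in> insert None (Some ` S)"
      using inS by eventually_elim (auto simp: W_def)
    show "(\<lambda>\<omega>. \<psi> (W \<omega>)) \<in> borel_measurable M" by (rule measurable_compose[OF mW]) simp
  qed (use finS in simp)
  also have "\<dots> = expectation (\<lambda>\<omega>. G1 (sX \<omega>) (word_X K \<omega>) (Y n \<omega>))"
    unfolding W_def \<psi>_def G1_def by (rule Bochner_Integration.integral_cong) simp_all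
  also have "\<dots> = expectation (\<lambda>\<omega>. G2 (sX \<omega>) (word_X K \<omega>) (Y n \<omega>))"
  proof -
    have fin: "finite (words V K)" by (intro finite_words) simp
    have if_sum: "(\<Sum>w\<in>words V K. if n < sum_list w then f w else 0)
        = (\<Sum>w | w \<in> words V K \<and> n < sum_list w. f w)" for f :: "nat list \<Rightarrow> real"
      by (rule sum.inter_filter[OF fin, symmetric])
    have "(\<Sum>w\<in>words V K. G1 s w y) = (\<Sum>w\<in>words V K. G2 s w y)" for s y
      unfolding G1_def G2_def if_sum pairs_def sum.cartesian_product[symmetric]
      by (rule sum_modified_blocks[OF l_pos refl])
    then show ?thesis unfolding expectation_X_word_Y by (simp only:)
  qed
  also have "\<dots> = expectation (\<lambda>\<omega>. (block_weight l n (word_X K \<omega>) + block_score l n (word_X K \<omega>))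
        * real (lcs (X n \<omega>) (Y n \<omega>)))"
  proof (rule Bochner_Integration.integral_cong[OF refl])
    fix \<omega>
    show "G2 (sX \<omega>) (word_X K \<omega>) (Y n \<omega>)
        = (block_weight l n (word_X K \<omega>) + block_score l n (word_X K \<omega>)) * real (lcs (X n \<omega>) (Y n \<omega>))"
    proof (cases "?ok \<omega>")
      case True
      then have "lc (sX \<omega>) (?bl \<omega>) (Y n \<omega>) = real (lcs (X n \<omega>) (Y n \<omega>))"
        unfolding lc_def by (simp only: X_eq_rest_string)
      then show ?thesis using True by (simp add: G2_def block_weight_def block_score_def)
    qed (simp add: G2_def block_weight_def block_score_def)
  qed
  finally show ?thesis .
qed

end

section \<open>Variance bounds\<close>

text \<open>A word with fewer than \<open>n\<close> symbols simply yields a shorter string; the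
  bounded difference property thus holds on every word.\<close>

definition word_lcs :: "nat \<Rightarrow> nat \<Rightarrow> nat list \<Rightarrow> nat \<Rightarrow> nat list \<Rightarrow> real" where
  "word_lcs n s w s' w' = real (lcs (take n (concat_blocks s w)) (take n (concat_blocks s' w')))"

lemma word_lcs_commute: "word_lcs n s w s' w' = word_lcs n s' w' s w"
  by (simp add: word_lcs_def lcs_commute)

lemma word_lcs_bounds: "0 \<le> word_lcs n s w s' w'" "word_lcs n s w s' w' \<le> real n"
  using lcs_le_length[of "take n (concat_blocks s w)" "take n (concat_blocks s' w')"]
  by (auto simp: word_lcs_def)

text \<open>The bound 2 is the span of the three lengths.\<close>

lemma word_lcs_update:
  assumes V: "V = {l - 1, l, l + 1}" and w: "w \<in> words V K" "k < K" "x \<in> V"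
  shows "\<bar>word_lcs n s (w[k := x]) s' w' - word_lcs n s w s' w'\<bar> \<le> 2"
proof -
  have k: "k < length w" using w by (simp add: words_def)
  then have "w ! k \<in> V" using w(1) by (auto simp: words_def)
  then have "x \<le> w ! k + 2" "w ! k \<le> x + 2" using V w(3) by auto
  from lcs_block_update[OF k this, of n s "take n (concat_blocks s' w')"]
  show ?thesis unfolding word_lcs_def by linarith
qed

text \<open>Rotation preserves the uniform law on words and reduces the flip of the first symbol to
  moving one block, at a cost of twice the maximal length \<open>l + 1\<close>.\<close>

lemma word_avg_flip_symbol:
  assumes V: "V = {l - 1, l, l + 1}"
  shows "\<bar>word_avg V (Suc K) (\<lambda>w. word_avg V K' (\<lambda>w'. word_lcs n (Suc s) w s' w'))
    - word_avg V (Suc K) (\<lambda>w. word_avg V K' (\<lambda>w'. word_lcs n s w s' w'))\<bar> \<le> 2 * real (l + 1)"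
proof -
  have V': "finite V" "V \<noteq> {}" using V by auto
  let ?f = "\<lambda>s w. word_avg V K' (\<lambda>w'. word_lcs n s w s' w')"
  have "\<bar>word_avg V (Suc K) (\<lambda>w. ?f (Suc s) (tl w @ [hd w])) - word_avg V (Suc K) (?f s)\<bar> \<le> 2 * real (l + 1)"
  proof (intro word_avg_abs_le V')
    fix w w' assume "w \<in> words V (Suc K)"
    then obtain x u where w: "w = x # u" "x \<in> V" by (cases w) (auto simp: words_def)
    have "x \<le> l + 1" using w(2) V by auto
    from lcs_rotate_blocks[OF this, of n s u "take n (concat_blocks s' w')"]
    show "\<bar>word_lcs n (Suc s) (tl w @ [hd w]) s' w' - word_lcs n s w s' w'\<bar> \<le> 2 * real (l + 1)"
      unfolding word_lcs_def w(1) list.sel by linarith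
  qed
  then show ?thesis unfolding word_avg_rotate[OF V'(1), of K "?f (Suc s)"] .
qed

lemma word_avg_swap:
  "word_avg V K (\<lambda>w. word_avg V K' (\<lambda>w'. f w w')) = word_avg V K' (\<lambda>w'. word_avg V K (\<lambda>w. f w w'))"
proof -
  have "(\<Sum>w\<in>words V K. (\<Sum>w'\<in>words V K'. f w w') / c) / d
      = (\<Sum>w'\<in>words V K'. (\<Sum>w\<in>words V K. f w w') / d) / c" for c d
    unfolding sum_divide_distrib[symmetric]
    by (subst sum.swap) (simp add: mult.commute)
  then show ?thesis by (simp only: word_avg_def)
qed

text \<open>The first symbols are random too, so one centre \<open>m 0 0\<close> has to serve all
  four pairs of symbols; the other means lie within a constant of it.\<close>

lemma word_avg_word_lcs_variance:
  assumes V: "V = {l - 1, l, l + 1}" and n: "n > 0" and s: "s \<in> {0, 1}" "s' \<in> {0, 1}"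
  defines "m \<equiv> \<lambda>s s'. word_avg V (2 * n) (\<lambda>w. word_avg V (2 * n) (\<lambda>w'. word_lcs n s w s' w'))"
  shows "word_avg V (2 * n) (\<lambda>w. word_avg V (2 * n) (\<lambda>w'. (word_lcs n s w s' w' - m 0 0)\<^sup>2))
    \<le> 32 * real n + 32 * (real (l + 1))\<^sup>2"
proof -
  have V': "finite V" "V \<noteq> {}" using V by auto
  let ?A = "word_avg V (2 * n)"
  let ?f = "word_lcs n s"
  define h where "h w = ?A (\<lambda>w'. ?f w s' w')" for w
  obtain K where K: "2 * n = Suc K" using n by (cases "2 * n") auto
  \<comment> \<open>Total variance over the two words: \<open>w'\<close> around \<open>h w\<close>
    and \<open>h w\<close> around its mean. Each word has \<open>2 n\<close> letters with
    differences at most 2, hence \<open>8 n\<close> twice.\<close>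
  have "?A (\<lambda>w. ?A (\<lambda>w'. (?f w s' w' - m s s')\<^sup>2)) \<le> ?A (\<lambda>w. 8 * real n + (h w - m s s')\<^sup>2)"
  proof (rule word_avg_mono)
    fix w
    have "?A (\<lambda>w'. (?f w s' w' - m s s')\<^sup>2) = ?A (\<lambda>w'. (?f w s' w' - h w)\<^sup>2) + (h w - m s s')\<^sup>2"
      unfolding h_def by (rule word_avg_second_moment_shift[OF V'])
    moreover have "?A (\<lambda>w'. (?f w s' w' - h w)\<^sup>2) \<le> real (2 * n) * 2\<^sup>2"
      unfolding h_def
    proof (rule word_avg_bounded_diff_variance[OF V'])
      fix w' k x assume "w' \<in> words V (2 * n)" "k < 2 * n" "x \<in> V"
      then show "\<bar>?f w s' (w'[k := x]) - ?f w s' w'\<bar> \<le> 2"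
        unfolding word_lcs_commute[of n s] by (rule word_lcs_update[OF V])
    qed
    ultimately show "?A (\<lambda>w'. (?f w s' w' - m s s')\<^sup>2) \<le> 8 * real n + (h w - m s s')\<^sup>2" by simp
  qed
  also have "\<dots> = 8 * real n + ?A (\<lambda>w. (h w - m s s')\<^sup>2)"
    by (simp only: word_avg_add word_avg_const[OF V'])
  also have "?A (\<lambda>w. (h w - m s s')\<^sup>2) \<le> real (2 * n) * 2\<^sup>2"
  proof -
    have "m s s' = ?A h" by (simp add: m_def h_def[abs_def])
    then show ?thesis
    proof (simp only:, intro word_avg_bounded_diff_variance[OF V'])
      fix w k x assume w: "w \<in> words V (2 * n)" "k < 2 * n" "x \<in> V"
      show "\<bar>h (w[k := x]) - h w\<bar> \<le> 2"
        unfolding h_def by (intro word_avg_abs_le V' word_lcs_update[OF V w])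
    qed
  qed
  finally have var: "?A (\<lambda>w. ?A (\<lambda>w'. (?f w s' w' - m s s')\<^sup>2)) \<le> 16 * real n" by simp
  have flip: "\<bar>m 1 t - m 0 t\<bar> \<le> 2 * real (l + 1)" for t
    using word_avg_flip_symbol[OF V, of K "Suc K" n 0 t] unfolding m_def K One_nat_def .
  have comm: "m t t' = m t' t" for t t'
    unfolding m_def by (subst word_avg_swap) (simp only: word_lcs_commute[of n t])
  \<comment> \<open>At most two symbols have to be flipped; the second is reached through the
    symmetry \<open>comm\<close>.\<close>
  have "\<bar>m s s' - m 0 0\<bar> \<le> 4 * real (l + 1)"
    using flip[of 0] flip[of 1] comm[of 0 1] s by auto
  then have near: "(m s s' - m 0 0)\<^sup>2 \<le> (4 * real (l + 1))\<^sup>2"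
    using power_mono[of "\<bar>m s s' - m 0 0\<bar>" _ 2] by simp
  have "?A (\<lambda>w. ?A (\<lambda>w'. (?f w s' w' - m 0 0)\<^sup>2))
      \<le> ?A (\<lambda>w. ?A (\<lambda>w'. 2 * (?f w s' w' - m s s')\<^sup>2 + 2 * (4 * real (l + 1))\<^sup>2))"
  proof (intro word_avg_mono)
    fix w w'
    have "(a - c)\<^sup>2 \<le> 2 * (a - b)\<^sup>2 + 2 * (b - c)\<^sup>2" for a b c :: real
      using zero_le_power2[of "(a - b) - (b - c)"] by (simp add: power2_eq_square algebra_simps)
    from this[of "?f w s' w'" "m 0 0" "m s s'"] near
    show "(?f w s' w' - m 0 0)\<^sup>2 \<le> 2 * (?f w s' w' - m s s')\<^sup>2 + 2 * (4 * real (l + 1))\<^sup>2"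
      by linarith
  qed
  also have "\<dots> = 2 * ?A (\<lambda>w. ?A (\<lambda>w'. (?f w s' w' - m s s')\<^sup>2)) + 2 * (4 * real (l + 1))\<^sup>2"
    by (simp only: word_avg_add word_avg_cmult word_avg_const[OF V'])
  also have "\<dots> \<le> 2 * (16 * real n) + 2 * (4 * real (l + 1))\<^sup>2"
    using var by simp
  also have "\<dots> = 32 * real n + 32 * (real (l + 1))\<^sup>2"
    unfolding power_mult_distrib by simp
  finally show ?thesis .
qed

text \<open>The constant function 1 in \<open>sum_modified_blocks\<close> equates the averages of
  \<open>a c\<close> and \<open>m (m - 1)\<close>.\<close>

lemma word_avg_block_score:
  assumes l: "l > 0" and V: "V = {l - 1, l, l + 1}"
  shows "word_avg V K (block_score l n) = 0"
proof -
  have fin: "finite (words V K)" using V by (intro finite_words) simp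
  have if_sum: "(\<Sum>w\<in>words V K. if n < sum_list w then f w else 0)
      = (\<Sum>w | w \<in> words V K \<and> n < sum_list w. f w)" for f :: "nat list \<Rightarrow> real"
    by (rule sum.inter_filter[OF fin, symmetric])
  have "(\<Sum>w\<in>words V K. block_score l n w) = 0"
    using sum_modified_blocks[OF l V, where K = K and n = n and G = "\<lambda>_. 1"]
    unfolding block_score_def if_sum by (simp add: sum_subtractf)
  then show ?thesis by (simp add: word_avg_def)
qed

lemma (in prob_space) variance_le_second_moment:
  fixes Z :: "'a \<Rightarrow> real"
  assumes "integrable M Z" "integrable M (\<lambda>\<omega>. (Z \<omega>)\<^sup>2)"
  shows "variance Z \<le> expectation (\<lambda>\<omega>. (Z \<omega> - c)\<^sup>2)"
proof -
  have "expectation (\<lambda>\<omega>. (Z \<omega> - c)\<^sup>2) = expectation (\<lambda>\<omega>. ((Z \<omega>)\<^sup>2 - 2 * c * Z \<omega>) + c\<^sup>2)"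
    by (rule Bochner_Integration.integral_cong) (auto simp: power2_eq_square algebra_simps)
  also have "\<dots> = expectation (\<lambda>\<omega>. (Z \<omega>)\<^sup>2) - 2 * c * expectation Z + c\<^sup>2"
    using assms by (simp add: prob_space)
  also have "\<dots> = variance Z + (expectation Z - c)\<^sup>2"
    using variance_eq[OF assms] by (simp add: power2_eq_square algebra_simps)
  finally show ?thesis by simp
qed

section \<open>The two variance bounds for the random strings\<close>

context block_model
begin

definition lcs_XY :: "nat \<Rightarrow> 'a \<Rightarrow> real" where
  "lcs_XY n \<omega> = real (lcs (X n \<omega>) (Y n \<omega>))"

definition lcs_X'Y :: "nat \<Rightarrow> 'a \<Rightarrow> real" where
  "lcs_X'Y n \<omega> = real (lcs (X' n \<omega>) (Y n \<omega>))"

lemma measurable_lcs [measurable]: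
  "lcs_XY n \<in> borel_measurable M" "lcs_X'Y n \<in> borel_measurable M"
proof -
  have "(\<lambda>\<omega>. (X n \<omega>, Y n \<omega>)) \<in> measurable M (count_space UNIV)"
    "(\<lambda>\<omega>. (X' n \<omega>, Y n \<omega>)) \<in> measurable M (count_space UNIV)"
    by (intro measurable_count_space_comp2[where F = Pair] measurable_X measurable_X' measurable_Y)+
  from this[THEN measurable_compose, of "\<lambda>(x, y). real (lcs x y)" borel]
  show "lcs_XY n \<in> borel_measurable M" "lcs_X'Y n \<in> borel_measurable M"
    by (simp_all add: lcs_XY_def[abs_def] lcs_X'Y_def[abs_def])
qed

lemma lcs_bounds:
  "0 \<le> lcs_XY n \<omega>" "lcs_XY n \<omega> \<le> real n" "0 \<le> lcs_X'Y n \<omega>" "lcs_X'Y n \<omega> \<le> real n"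
  using lcs_le_length[of "X n \<omega>" "Y n \<omega>"] lcs_le_length[of "X' n \<omega>" "Y n \<omega>"]
  by (auto simp: lcs_XY_def lcs_X'Y_def X_eq X'_eq block_string_def)

lemma integrable_lcs [simp]: "integrable M (lcs_XY n)" "integrable M (lcs_X'Y n)"
  by (rule integrable_const_bound[where B = "real n"]; use lcs_bounds in simp)+

lemma integrable_lcs_square [simp]: "integrable M (\<lambda>\<omega>. (lcs_XY n \<omega>)\<^sup>2)"
  by (rule integrable_const_bound[where B = "(real n)\<^sup>2"]) (use lcs_bounds in \<open>simp_all add: power_mono\<close>)

lemma variance_upper:
  assumes n: "n > 0"
  shows "variance (lcs_XY n) \<le> (72 + 64 * (real (l + 1))\<^sup>2) * real n"
proof -
  let ?A = "word_avg V (2 * n)"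
  define c where "c = ?A (\<lambda>w. ?A (\<lambda>w'. word_lcs n 0 w 0 w'))"
  define Z where "Z \<omega> = word_lcs n (sX \<omega>) (word_X (2 * n) \<omega>) (sY \<omega>) (word_Y (2 * n) \<omega>)" for \<omega>
  \<comment> \<open>Off this event both words cover \<open>n\<close> symbols and \<open>Z\<close> is
    the true length. On it the squared error is at most \<open>n\<^sup>2\<close>, against a
    probability of at most \<open>4 / n\<close>, so the cost is linear in \<open>n\<close>.\<close>
  define bad where "bad = {\<omega> \<in> space M. sum_list (word_X (2 * n) \<omega>) \<le> n}
    \<union> {\<omega> \<in> space M. sum_list (word_Y (2 * n) \<omega>) \<le> n}"
  have ev: "{\<omega> \<in> space M. sum_list (word_X (2 * n) \<omega>) \<le> n} \<in> events"
    "{\<omega> \<in> space M. sum_list (word_Y (2 * n) \<omega>) \<le> n} \<in> events"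
    by (rule events_of_measurable[OF measurable_word(1)], rule events_of_measurable[OF measurable_word(2)])
  then have bad_ev: "bad \<in> events" by (simp add: bad_def)
  have "prob bad \<le> 2 / real n + 2 / real n"
    unfolding bad_def using measure_Un_le[OF ev] prob_short[OF n] by linarith
  then have "(real n)\<^sup>2 * prob bad \<le> (real n)\<^sup>2 * (4 / real n)"
    by (intro mult_left_mono) auto
  then have bad: "(real n)\<^sup>2 * prob bad \<le> 4 * real n" using n by (simp add: power2_eq_square)
  have Zm: "Z \<in> borel_measurable M"
  proof -
    have "(\<lambda>\<omega>. (sX \<omega>, word_X (2 * n) \<omega>, sY \<omega>, word_Y (2 * n) \<omega>)) \<in> measurable M (count_space UNIV)"
      by (intro measurable_count_space_comp2[where F = Pair] measurable_sources measurable_word)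
    from measurable_compose[OF this, of "\<lambda>(s, w, s', w'). word_lcs n s w s' w'" borel]
    show ?thesis by (simp add: Z_def[abs_def])
  qed
  have Zb: "0 \<le> Z \<omega>" "Z \<omega> \<le> real n" for \<omega> unfolding Z_def by (rule word_lcs_bounds)+
  have Zi: "integrable M (\<lambda>\<omega>. (Z \<omega> - c)\<^sup>2)"
  proof (rule integrable_const_bound[where B = "(real n + \<bar>c\<bar>)\<^sup>2"])
    show "AE \<omega> in M. norm ((Z \<omega> - c)\<^sup>2) \<le> (real n + \<bar>c\<bar>)\<^sup>2"
    proof (rule AE_I2)
      fix \<omega>
      have "\<bar>Z \<omega> - c\<bar> \<le> real n + \<bar>c\<bar>" using Zb[of \<omega>] by linarith
      from power_mono[OF this, of 2] show "norm ((Z \<omega> - c)\<^sup>2) \<le> (real n + \<bar>c\<bar>)\<^sup>2" by simp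
    qed
  qed (use Zm in measurable)
  have "variance (lcs_XY n) \<le> expectation (\<lambda>\<omega>. (lcs_XY n \<omega> - c)\<^sup>2)"
    by (rule variance_le_second_moment) simp_all
  also have "\<dots> \<le> expectation (\<lambda>\<omega>. 2 * (real n)\<^sup>2 * indicator bad \<omega> + 2 * (Z \<omega> - c)\<^sup>2)"
  proof (rule integral_mono)
    show "integrable M (\<lambda>\<omega>. (lcs_XY n \<omega> - c)\<^sup>2)"
      by (simp add: power2_diff integrable_diff)
    show "integrable M (\<lambda>\<omega>. 2 * (real n)\<^sup>2 * indicator bad \<omega> + 2 * (Z \<omega> - c)\<^sup>2)"
      using bad_ev Zi by (intro Bochner_Integration.integrable_add) (auto simp: emeasure_eq_measure)
    fix \<omega> assume \<omega>: "\<omega> \<in> space M"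
    show "(lcs_XY n \<omega> - c)\<^sup>2 \<le> 2 * (real n)\<^sup>2 * indicator bad \<omega> + 2 * (Z \<omega> - c)\<^sup>2"
    proof (cases "\<omega> \<in> bad")
      case True
      have "\<bar>lcs_XY n \<omega> - Z \<omega>\<bar> \<le> real n"
        using Zb[of \<omega>] lcs_bounds[of n \<omega>] by linarith
      from power_mono[OF this, of 2] have "(lcs_XY n \<omega> - Z \<omega>)\<^sup>2 \<le> (real n)\<^sup>2" by simp
      moreover have "(a - c)\<^sup>2 \<le> 2 * (a - b)\<^sup>2 + 2 * (b - c)\<^sup>2" for a b c :: real
        using zero_le_power2[of "(a - b) - (b - c)"] by (simp add: power2_eq_square algebra_simps)
      note this[of "lcs_XY n \<omega>" c "Z \<omega>"]
      ultimately show ?thesis using True by simp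
    next
      case False
      then have "n \<le> sum_list (word_X (2 * n) \<omega>)" "n \<le> sum_list (word_Y (2 * n) \<omega>)"
        using \<omega> by (auto simp: bad_def)
      then have "lcs_XY n \<omega> = Z \<omega>"
        unfolding lcs_XY_def Z_def word_lcs_def by (simp only: X_eq_take Y_eq_take)
      then show ?thesis using False by simp
    qed
  qed
  also have "\<dots> = 2 * ((real n)\<^sup>2 * prob bad) + 2 * expectation (\<lambda>\<omega>. (Z \<omega> - c)\<^sup>2)"
    using bad_ev Zi by (subst Bochner_Integration.integral_add) (auto simp: emeasure_eq_measure)
  also have "expectation (\<lambda>\<omega>. (Z \<omega> - c)\<^sup>2)
      = (\<Sum>s\<in>{0, 1}. \<Sum>s'\<in>{0, 1}. 1 / 4 * ?A (\<lambda>w. ?A (\<lambda>w'. (word_lcs n s w s' w' - c)\<^sup>2)))"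
    unfolding Z_def by (rule expectation_words[of "\<lambda>s w s' w'. (word_lcs n s w s' w' - c)\<^sup>2" "2 * n"])
  also have "\<dots> \<le> (\<Sum>s\<in>{0, 1 :: nat}. \<Sum>s'\<in>{0, 1 :: nat}. 1 / 4 * (32 * real n + 32 * (real (l + 1))\<^sup>2))"
    unfolding c_def by (intro sum_mono mult_left_mono word_avg_word_lcs_variance[OF refl n]) auto
  also have "\<dots> = 32 * real n + 32 * (real (l + 1))\<^sup>2" by simp
  finally have "variance (lcs_XY n) \<le> 2 * (4 * real n) + 2 * (32 * real n + 32 * (real (l + 1))\<^sup>2)"
    using bad by linarith
  also have "\<dots> = 72 * real n + 64 * (real (l + 1))\<^sup>2 * 1" by simp
  also have "\<dots> \<le> 72 * real n + 64 * (real (l + 1))\<^sup>2 * real n"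
    using n by (intro add_left_mono mult_left_mono) auto
  also have "\<dots> = (72 + 64 * (real (l + 1))\<^sup>2) * real n" by (simp add: distrib_right)
  finally show ?thesis .
qed

text \<open>The word almost surely takes finitely many values, so every function of it is almost
  surely bounded.\<close>

lemma integrable_word_X_mult:
  fixes g :: "nat list \<Rightarrow> real"
  assumes F: "F \<in> borel_measurable M" "\<And>\<omega>. \<bar>F \<omega>\<bar> \<le> c"
  shows "integrable M (\<lambda>\<omega>. g (word_X K \<omega>) * F \<omega>)"
proof (rule integrable_const_bound[where B = "(\<Sum>w\<in>words V K. \<bar>g w\<bar>) * c"])
  have fin: "finite (words V K)" by (intro finite_words) simp
  show "AE \<omega> in M. norm (g (word_X K \<omega>) * F \<omega>) \<le> (\<Sum>w\<in>words V K. \<bar>g w\<bar>) * c"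
    using AE_words(1)[of K]
  proof eventually_elim
    case (elim \<omega>)
    have "\<bar>g (word_X K \<omega>)\<bar> \<le> (\<Sum>w\<in>words V K. \<bar>g w\<bar>)"
      by (rule member_le_sum[OF elim _ fin]) simp
    then show ?case unfolding real_norm_def abs_mult
      by (intro mult_mono F(2)) (auto intro: sum_nonneg)
  qed
  have "(\<lambda>\<omega>. g (word_X K \<omega>)) \<in> borel_measurable M"
    by (rule measurable_compose[OF measurable_word(1)]) simp
  then show "(\<lambda>\<omega>. g (word_X K \<omega>) * F \<omega>) \<in> borel_measurable M"
    using F(1) by measurable
qed

lemma integrable_word_X: "integrable M (\<lambda>\<omega>. g (word_X K \<omega>) :: real)"
  using integrable_word_X_mult[of "\<lambda>_. 1" 1 g K] by simp

lemma variance_lower: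
  assumes n: "n > 0" and \<delta>: "\<delta> > 0"
    and bias: "\<delta> \<le> expectation (\<lambda>\<omega>. lcs_X'Y n \<omega> - lcs_XY n \<omega>)"
    and large: "3600 * (real l)\<^sup>2 \<le> \<delta> * sqrt (real n)"
  shows "(\<delta> / (18 * (real l)\<^sup>2))\<^sup>2 / 156 * real n \<le> variance (lcs_XY n)"
proof -
  define h where "h \<omega> = block_weight l n (word_X (2 * n) \<omega>)" for \<omega>
  define W where "W \<omega> = block_score l n (word_X (2 * n) \<omega>)" for \<omega>
  define D where "D \<omega> = lcs_X'Y n \<omega> - lcs_XY n \<omega>" for \<omega>
  define e where "e = expectation (lcs_XY n)"
  define \<beta> where "\<beta> = \<delta> / (18 * (real l)\<^sup>2)"
  let ?\<mu> = "(real n / (3 * real l))\<^sup>2"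
  have \<beta>: "\<beta> > 0" using \<delta> l_pos by (simp add: \<beta>_def)
  have iD: "integrable M D" unfolding D_def by simp
  have bL: "\<bar>lcs_XY n \<omega>\<bar> \<le> real n" "\<bar>lcs_X'Y n \<omega>\<bar> \<le> real n" for \<omega>
    using lcs_bounds[of n \<omega>] by auto
  have ih: "integrable M h" "integrable M (\<lambda>\<omega>. h \<omega> * lcs_XY n \<omega>)" "integrable M (\<lambda>\<omega>. h \<omega> * lcs_X'Y n \<omega>)"
    "integrable M (\<lambda>\<omega>. \<bar>h \<omega> - ?\<mu>\<bar>)"
    unfolding h_def using bL
    by (auto intro!: integrable_word_X integrable_word_X_mult
        integrable_word_X[of "\<lambda>w. \<bar>block_weight l n w - ?\<mu>\<bar>"])
  have iW: "integrable M W" "integrable M (\<lambda>\<omega>. W \<omega> * lcs_XY n \<omega>)" "integrable M (\<lambda>\<omega>. (W \<omega>)\<^sup>2)"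
    unfolding W_def using bL
    by (auto intro!: integrable_word_X integrable_word_X_mult
        integrable_word_X[of "\<lambda>w. (block_score l n w)\<^sup>2"])
  have eW: "expectation W = 0"
    unfolding W_def expectation_word_X by (rule word_avg_block_score[OF l_pos refl])
  have eW2: "expectation (\<lambda>\<omega>. (W \<omega>)\<^sup>2) \<le> 156 * real n ^ 3"
    unfolding W_def expectation_word_X[of "\<lambda>w. (block_score l n w)\<^sup>2"]
    by (rule word_avg_block_score_square[OF l_pos refl n])
  have eh: "expectation (\<lambda>\<omega>. \<bar>h \<omega> - ?\<mu>\<bar>) \<le> 100 * (real n * sqrt (real n))"
    unfolding h_def expectation_word_X[of "\<lambda>w. \<bar>block_weight l n w - ?\<mu>\<bar>"]
    by (rule word_avg_block_weight[OF l_pos refl n])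
  have "expectation (\<lambda>\<omega>. h \<omega> * lcs_X'Y n \<omega>) = expectation (\<lambda>\<omega>. (h \<omega> + W \<omega>) * lcs_XY n \<omega>)"
    unfolding h_def W_def lcs_X'Y_def lcs_XY_def by (rule expectation_weight_modified[OF n])
  also have "\<dots> = expectation (\<lambda>\<omega>. h \<omega> * lcs_XY n \<omega>) + expectation (\<lambda>\<omega>. W \<omega> * lcs_XY n \<omega>)"
    using ih iW by (simp add: distrib_right)
  finally have hD: "expectation (\<lambda>\<omega>. h \<omega> * D \<omega>) = expectation (\<lambda>\<omega>. W \<omega> * lcs_XY n \<omega>)"
    unfolding D_def right_diff_distrib using ih by simp
  have ihD: "integrable M (\<lambda>\<omega>. h \<omega> * D \<omega>)"
    unfolding D_def right_diff_distrib using ih by simp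
  \<comment> \<open>Replacing the weight \<open>h\<close> by the constant \<open>?\<mu>\<close>
    costs at most twice their distance, because \<open>D\<close> almost surely lies between -2 and
    2; 200 is twice the constant of \<open>word_avg_block_weight\<close>.\<close>
  have "?\<mu> * \<delta> - 200 * (real n * sqrt (real n))
      \<le> ?\<mu> * expectation D - 2 * expectation (\<lambda>\<omega>. \<bar>h \<omega> - ?\<mu>\<bar>)"
  proof -
    have "?\<mu> * \<delta> \<le> ?\<mu> * expectation D"
      using bias unfolding D_def by (intro mult_left_mono) auto
    then show ?thesis using eh by linarith
  qed
  also have "\<dots> = expectation (\<lambda>\<omega>. ?\<mu> * D \<omega> - 2 * \<bar>h \<omega> - ?\<mu>\<bar>)"
    using iD ih by simp
  also have "\<dots> \<le> expectation (\<lambda>\<omega>. h \<omega> * D \<omega>)"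
  proof (rule integral_mono_AE)
    show "AE \<omega> in M. ?\<mu> * D \<omega> - 2 * \<bar>h \<omega> - ?\<mu>\<bar> \<le> h \<omega> * D \<omega>"
      using AE_lcs_modified[of n]
    proof eventually_elim
      case (elim \<omega>)
      then have "\<bar>(?\<mu> - h \<omega>) * D \<omega>\<bar> \<le> \<bar>h \<omega> - ?\<mu>\<bar> * 2"
        unfolding abs_mult D_def lcs_XY_def lcs_X'Y_def by (intro mult_mono) auto
      then have "?\<mu> * D \<omega> - h \<omega> * D \<omega> \<le> \<bar>h \<omega> - ?\<mu>\<bar> * 2"
        unfolding left_diff_distrib by linarith
      then show ?case by linarith
    qed
  qed (use iD ih ihD in simp_all)
  \<comment> \<open>Since \<open>W\<close> has mean zero, the length may be centred at
    \<open>e\<close>.\<close>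
  also have "\<dots> = expectation (\<lambda>\<omega>. W \<omega> * (lcs_XY n \<omega> - e))"
    unfolding hD right_diff_distrib using iW eW by simp
  finally have lower: "?\<mu> * \<delta> - 200 * (real n * sqrt (real n))
      \<le> expectation (\<lambda>\<omega>. W \<omega> * (lcs_XY n \<omega> - e))" .
  \<comment> \<open>The main term is twice \<open>\<beta> * n\<^sup>2\<close>, as
    \<open>\<beta>\<close> is half of \<open>\<delta> / (9 * l\<^sup>2)\<close>. The assumption
    \<open>large\<close> amounts to \<open>\<beta> * sqrt n >= 200\<close>, so the fluctuation of
    the weight consumes at most half of it.\<close>
  have "\<beta> * (real n)\<^sup>2 \<le> ?\<mu> * \<delta> - 200 * (real n * sqrt (real n))"
  proof -
    have \<mu>: "?\<mu> * \<delta> = 2 * (\<beta> * (real n)\<^sup>2)"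
      using l_pos by (simp add: \<beta>_def power_divide power_mult_distrib)
    have "200 \<le> \<beta> * sqrt (real n)"
      using large l_pos by (simp add: \<beta>_def field_simps)
    then have "200 * (real n * sqrt (real n)) \<le> \<beta> * sqrt (real n) * (real n * sqrt (real n))"
      by (intro mult_right_mono) auto
    also have "\<dots> = \<beta> * (real n * (sqrt (real n) * sqrt (real n)))" by (simp only: ac_simps)
    also have "\<dots> = \<beta> * (real n)\<^sup>2" by (simp add: power2_eq_square)
    finally show ?thesis using \<mu> by linarith
  qed
  note lower = order_trans[OF this lower]
  \<comment> \<open>Chosen so that the term with \<open>W\<close>, bounded by
    \<open>\<theta> / 2\<close> times \<open>156 * n ^ 3\<close>, is exactly half of the lower bound
    \<open>\<beta> * n\<^sup>2\<close>.\<close>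
  define \<theta> where "\<theta> = \<beta> / (156 * real n)"
  have \<theta>: "\<theta> > 0" using \<beta> n by (simp add: \<theta>_def)
  have iV: "integrable M (\<lambda>\<omega>. (lcs_XY n \<omega> - e)\<^sup>2)" by (simp add: power2_diff)
  have iWL: "integrable M (\<lambda>\<omega>. W \<omega> * (lcs_XY n \<omega> - e))"
    unfolding right_diff_distrib using iW by simp
  text \<open>Cauchy-Schwarz, in the form of the AM-GM inequality with weight \<open>\<theta>\<close>.\<close>
  have "expectation (\<lambda>\<omega>. W \<omega> * (lcs_XY n \<omega> - e))
      \<le> expectation (\<lambda>\<omega>. \<theta> / 2 * (W \<omega>)\<^sup>2 + 1 / (2 * \<theta>) * (lcs_XY n \<omega> - e)\<^sup>2)"
  proof (rule integral_mono[OF iWL])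
    fix \<omega>
    have "0 \<le> (\<theta> * W \<omega> - (lcs_XY n \<omega> - e))\<^sup>2" by simp
    then have "2 * \<theta> * (W \<omega> * (lcs_XY n \<omega> - e)) \<le> \<theta>\<^sup>2 * (W \<omega>)\<^sup>2 + (lcs_XY n \<omega> - e)\<^sup>2"
      by (simp add: power2_diff power_mult_distrib)
    then have "2 * \<theta> * (W \<omega> * (lcs_XY n \<omega> - e)) / (2 * \<theta>)
        \<le> (\<theta>\<^sup>2 * (W \<omega>)\<^sup>2 + (lcs_XY n \<omega> - e)\<^sup>2) / (2 * \<theta>)"
      using \<theta> by (intro divide_right_mono) auto
    then show "W \<omega> * (lcs_XY n \<omega> - e) \<le> \<theta> / 2 * (W \<omega>)\<^sup>2 + 1 / (2 * \<theta>) * (lcs_XY n \<omega> - e)\<^sup>2"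
      using \<theta> by (simp add: add_divide_distrib power2_eq_square)
  qed (use iW iV in simp)
  also have "\<dots> = \<theta> / 2 * expectation (\<lambda>\<omega>. (W \<omega>)\<^sup>2) + 1 / (2 * \<theta>) * variance (lcs_XY n)"
    using iW iV unfolding e_def by simp
  also have "\<dots> \<le> \<theta> / 2 * (156 * real n ^ 3) + 1 / (2 * \<theta>) * variance (lcs_XY n)"
    using eW2 \<theta> by (intro add_right_mono mult_left_mono) auto
  also have "\<theta> / 2 * (156 * real n ^ 3) = \<beta> * (real n)\<^sup>2 / 2"
    using n by (simp add: \<theta>_def power2_eq_square power3_eq_cube)
  finally have "\<beta> * (real n)\<^sup>2 / 2 \<le> 1 / (2 * \<theta>) * variance (lcs_XY n)" using lower by linarith
  then have "2 * \<theta> * (\<beta> * (real n)\<^sup>2 / 2) \<le> 2 * \<theta> * (1 / (2 * \<theta>) * variance (lcs_XY n))"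
    using \<theta> by (intro mult_left_mono) auto
  also have "\<dots> = variance (lcs_XY n)" using \<theta> by simp
  also have "2 * \<theta> * (\<beta> * (real n)\<^sup>2 / 2) = \<beta>\<^sup>2 / 156 * real n"
    using n by (simp add: \<theta>_def power2_eq_square)
  finally show ?thesis unfolding \<beta>_def .
qed

text \<open>The conditional expectation is almost surely at least -2, and at least
  \<open>\<epsilon>\<close> with probability at least \<open>1 - \<eta>\<close>; its mean is
  therefore at least \<open>(\<epsilon> + 2) * (1 - \<eta>) - 2\<close>.\<close>

lemma expectation_bias:
  assumes \<epsilon>: "\<epsilon> > 0" and \<eta>: "(\<epsilon> + 2) * \<eta> \<le> \<epsilon> / 2"
    and bias: "1 - \<eta> \<le> measure M {\<omega> \<in> space M.
      \<epsilon> \<le> real_cond_exp M (sigma_XY M (X n) (Y n)) (\<lambda>\<omega>. lcs_X'Y n \<omega> - lcs_XY n \<omega>) \<omega>}"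
  shows "\<epsilon> / 2 \<le> expectation (\<lambda>\<omega>. lcs_X'Y n \<omega> - lcs_XY n \<omega>)"
proof -
  let ?F = "sigma_XY M (X n) (Y n)"
  let ?D = "\<lambda>\<omega>. lcs_X'Y n \<omega> - lcs_XY n \<omega>"
  let ?R = "real_cond_exp M ?F ?D"
  have "(\<lambda>\<omega>. (X n \<omega>, Y n \<omega>)) \<in> measurable M (count_space UNIV)"
    by (rule measurable_count_space_comp2[OF measurable_X measurable_Y])
  then have "sets ?F \<subseteq> sets M"
    unfolding sigma_XY_def by (intro sets_image_in_sets) simp_all
  then have "subalgebra M ?F" by (simp add: subalgebra_def sigma_XY_def)
  then interpret F: finite_measure_subalgebra M ?F by unfold_locales
  have iD: "integrable M ?D" by simp
  have R2: "AE \<omega> in M. ?R \<omega> \<ge> - 2"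
  proof (rule F.real_cond_exp_ge_c[OF iD])
    show "AE \<omega> in M. - 2 \<le> ?D \<omega>"
      using AE_lcs_modified[of n]
      by eventually_elim (simp add: lcs_X'Y_def lcs_XY_def abs_le_iff)
  qed
  let ?G = "{\<omega> \<in> space M. \<epsilon> \<le> ?R \<omega>}"
  have G: "?G \<in> events" by measurable
  have "\<epsilon> / 2 \<le> (\<epsilon> + 2) * (1 - \<eta>) - 2" using \<eta> by (simp add: algebra_simps)
  also have "\<dots> \<le> (\<epsilon> + 2) * prob ?G - 2"
    using bias \<epsilon> by (intro diff_right_mono mult_left_mono) auto
  also have "\<dots> = expectation (\<lambda>\<omega>. (\<epsilon> + 2) * indicator ?G \<omega> - 2)"
    using G by (subst Bochner_Integration.integral_diff) (auto simp: emeasure_eq_measure prob_space)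
  also have "\<dots> \<le> expectation ?R"
  proof (rule integral_mono_AE)
    show "AE \<omega> in M. (\<epsilon> + 2) * indicator ?G \<omega> - 2 \<le> ?R \<omega>"
      using R2 by eventually_elim (auto simp: indicator_def)
    show "integrable M ?R" by (rule F.real_cond_exp_int(1)[OF iD])
  qed (use G in \<open>auto simp: emeasure_eq_measure\<close>)
  also have "\<dots> = expectation ?D" by (rule F.real_cond_exp_int(2)[OF iD])
  finally show ?thesis .
qed

end

text \<open>By \<open>x <= exp x\<close> the exponential is at most
  \<open>n powr - \<alpha>\<close>, which tends to 0.\<close>

lemma eventually_exp_powr_le:
  fixes c \<alpha> :: real
  assumes "\<alpha> > 0" "c > 0"
  shows "\<forall>\<^sub>F n in sequentially. exp (- (real n powr \<alpha>)) \<le> c"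
proof -
  have "((\<lambda>n. real n powr - \<alpha>) \<longlongrightarrow> 0) sequentially"
    using assms(1) by (intro tendsto_neg_powr filterlim_real_sequentially) simp
  then have "\<forall>\<^sub>F n in sequentially. real n powr - \<alpha> < c"
    using assms(2) by (rule order_tendstoD)
  with eventually_gt_at_top[of 0] show ?thesis
  proof eventually_elim
    case (elim n)
    have pos: "real n powr \<alpha> > 0" using elim(1) by simp
    have "real n powr \<alpha> \<le> exp (real n powr \<alpha>)"
      using exp_ge_add_one_self[of "real n powr \<alpha>"] by linarith
    then have "inverse (exp (real n powr \<alpha>)) \<le> inverse (real n powr \<alpha>)"
      using pos by (intro le_imp_inverse_le)
    then show ?case using elim(2) by (simp add: exp_minus powr_minus)
  qed
qed

theorem theorem1p2:
  fixes M :: "'a measure" and l :: nat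
    and sX sY :: "'a \<Rightarrow> nat" and BX BY I J :: "nat \<Rightarrow> 'a \<Rightarrow> nat"
    and X Y X' :: "nat \<Rightarrow> 'a \<Rightarrow> nat list"
    and L L' :: "nat \<Rightarrow> 'a \<Rightarrow> real"
  assumes model: "block_model M l sX sY BX BY I J X Y X'"
    and L: "\<And>n \<omega>. L n \<omega> = real (lcs (X n \<omega>) (Y n \<omega>))"
    and L': "\<And>n \<omega>. L' n \<omega> = real (lcs (X' n \<omega>) (Y n \<omega>))"
    and bias: "\<exists>\<epsilon>>0. \<exists>\<alpha>>0. \<forall>\<^sub>F n in sequentially.
      measure M {\<omega> \<in> space M.
          real_cond_exp M (sigma_XY M (X n) (Y n)) (\<lambda>\<omega>. L' n \<omega> - L n \<omega>) \<omega> \<ge> \<epsilon>}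
        \<ge> 1 - exp (- (real n powr \<alpha>))"
  shows "\<exists>C\<^sub>1 C\<^sub>2. 0 < C\<^sub>1 \<and> C\<^sub>1 \<le> C\<^sub>2 \<and>
    (\<forall>\<^sub>F n in sequentially.
      C\<^sub>1 * real n \<le> prob_space.variance M (L n) \<and>
      prob_space.variance M (L n) \<le> C\<^sub>2 * real n)"
proof -
  interpret block_model M l sX sY BX BY I J X Y X' by (rule model)
  have L_eq: "L n = lcs_XY n" for n by (rule ext) (simp add: L lcs_XY_def)
  have L'_eq: "L' n = lcs_X'Y n" for n by (rule ext) (simp add: L' lcs_X'Y_def)
  obtain \<epsilon> \<alpha> where \<epsilon>: "\<epsilon> > 0" and \<alpha>: "\<alpha> > 0" and ev: "\<forall>\<^sub>F n in sequentially.
      1 - exp (- (real n powr \<alpha>)) \<le> measure M {\<omega> \<in> space M.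
        \<epsilon> \<le> real_cond_exp M (sigma_XY M (X n) (Y n)) (\<lambda>\<omega>. lcs_X'Y n \<omega> - lcs_XY n \<omega>) \<omega>}"
    using bias unfolding L_eq L'_eq by blast
  define C1 where "C1 = (\<epsilon> / 2 / (18 * (real l)\<^sup>2))\<^sup>2 / 156"
  define C2 where "C2 = 72 + 64 * (real (l + 1))\<^sup>2"
  have C1: "C1 > 0" using \<epsilon> l_pos by (simp add: C1_def)
  \<comment> \<open>The failure probability at which the gain \<open>\<epsilon>\<close> still
    outweighs losses of at most 2 with \<open>\<epsilon> / 2\<close> to spare.\<close>
  have "\<epsilon> / (2 * (\<epsilon> + 2)) > 0" using \<epsilon> by simp
  note small = eventually_exp_powr_le[OF \<alpha> this]
  \<comment> \<open>The size condition of \<open>variance_lower\<close> for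
    \<open>\<delta> = \<epsilon> / 2\<close>.\<close>
  have "\<forall>\<^sub>F n in sequentially. 3600 * (real l)\<^sup>2 / (\<epsilon> / 2) \<le> sqrt (real n)"
    using filterlim_compose[OF sqrt_at_top filterlim_real_sequentially]
    unfolding filterlim_at_top by blast
  with ev small eventually_gt_at_top[of 0]
  have main: "\<forall>\<^sub>F n in sequentially. C1 * real n \<le> variance (L n) \<and> variance (L n) \<le> C2 * real n"
  proof eventually_elim
    case (elim n)
    have "(\<epsilon> + 2) * exp (- (real n powr \<alpha>)) \<le> (\<epsilon> + 2) * (\<epsilon> / (2 * (\<epsilon> + 2)))"
      using elim(2) \<epsilon> by (intro mult_left_mono) auto
    also have "\<dots> = \<epsilon> / 2"
    proof -
      have "c * (b / (2 * c)) = b / 2" if "c > 0" for b c :: real using that by simp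
      from this[of "\<epsilon> + 2" \<epsilon>] show ?thesis using \<epsilon> by simp
    qed
    finally have "\<epsilon> / 2 \<le> expectation (\<lambda>\<omega>. lcs_X'Y n \<omega> - lcs_XY n \<omega>)"
      using expectation_bias[OF \<epsilon> _ elim(1)] by blast
    moreover have "3600 * (real l)\<^sup>2 \<le> \<epsilon> / 2 * sqrt (real n)"
      using elim(4) \<epsilon> by (simp add: field_simps)
    ultimately have "C1 * real n \<le> variance (lcs_XY n)"
      unfolding C1_def using \<epsilon> by (intro variance_lower[OF elim(3)]) auto
    then show ?case
      using variance_upper[OF elim(3)] unfolding L_eq C2_def by simp
  qed
  \<comment> \<open>Taking the maximum as upper constant puts the two constants in the required
    order.\<close>
  then have "\<forall>\<^sub>F n in sequentially. C1 * real n \<le> variance (L n) \<and> variance (L n) \<le> max C1 C2 * real n"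
  proof eventually_elim
    case (elim n)
    have "C2 * real n \<le> max C1 C2 * real n" by (intro mult_right_mono) auto
    then show ?case using elim by linarith
  qed
  then show ?thesis using C1 by (intro exI[of _ C1] exI[of _ "max C1 C2"]) auto
qed

end
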